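(* Assume there is a constant $C_{\rm stab}(\kappa,\Omega)$ such that every $w$ that is elementwise Helmholtz on $\mathcal T_h$ satisfies $$\begin{aligned}\|w\|_{L^2(\Omega)}\le C_{\rm stab}(\kappa,\Omega)\Big(&\sum_{e\in\mathcal E_h^{\rm I}}\big[\kappa\|[\![w]\!]\|_{L^2(e)}^2+\kappa^{-1}\|[\![\nabla_hw]\!]_n\|_{L^2(e)}^2\big]\\&+\kappa\|w\|_{L^2(\Gamma_D)}^2+\kappa^{-1}\|\partial_nw+i\kappa w\|_{L^2(\Gamma_R)}^2\Big)^{1/2},\end{aligned}$$ where $C_{\rm stab}(\kappa,\Omega)$ is independent of the particular broken representation of $w$. Let $u$ solve $$\Delta u+\kappa^2u=0\ \text{in }\Omega,\qquad u=g\ \text{on }\Gamma_D,\qquad \partial_nu+i\kappa u=0\ \text{on }\Gamma_R,$$ and let $v_h$ be any broken Trefftz field. Then $$\|u-v_h\|_{L^2(\Omega)}\le C_J(\alpha,\beta)\,C_{\rm stab}(\kappa,\Omega)\,\mathcal J(v_h)^{1/2},$$ where $$C_J(\alpha,\beta):=\sqrt{\max\{\alpha^{-1},\beta^{-1},2\}}.$$ In particular, $C_J(1/2,1/2)=\sqrt2$.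
   Context: $\Omega\subset\mathbb R^2$ is a bounded Lipschitz domain with $\partial\Omega=\Gamma_D\,\dot\cup\,\Gamma_R$, outward unit normal $n$; $\kappa>0$ is a constant wavenumber; $g$ is Dirichlet data on $\Gamma_D$; $\alpha,\beta>0$. $\mathcal T_h$ is a mesh of $\Omega$ with set of interior edges $\mathcal E_h^{\rm I}$, and $\nabla_h$ is the elementwise gradient. A function $w$ is "elementwise Helmholtz", or a "broken Trefftz field", if $\Delta w+\kappa^2w=0$ in each element $K\in\mathcal T_h$ (no continuity between elements is required); functions considered have traces for which the edge integrals make sense. (In the paper the discrete fields are elementwise linear combinations of plane waves $\exp(i\kappa(\cos z,\sin z)\cdot(x-x_K))$ with complex angles $z$.) On an interior edge $e=\partial K^+\cap\partial K^-$ with outward normals $n^\pm$: $[\![v]\!]=v^+n^++v^-n^-$ for scalar traces (vector valued) and $[\![\tau]\!]_n=\tau^+\cdot n^++\tau^-\cdot n^-$ for vector traces (scalar valued). The skeleton residual of a broken Trefftz field $v_h$ is $$\begin{aligned}\mathcal J(v_h)=&\sum_{e\in\mathcal E_h^{\rm I}}\int_e\Big[\alpha\kappa\,|[\![v_h]\!]|^2+\frac{\beta}{\kappa}\,|[\![\nabla_hv_h]\!]_n|^2\Big]ds+\alpha\kappa\int_{\Gamma_D}|v_h-g|^2\,ds\\&+\frac1{2\kappa}\int_{\Gamma_R}|\partial_nv_h+i\kappa v_h|^2\,ds.\end{aligned}$$ *)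

theory Defs
  imports "HOL-Analysis.Analysis"
begin

type_synonym plane = "real^2"

section \<open>Arc-length measure: one-dimensional Hausdorff measure\<close>

definition hausdorff1_pre :: "real \<Rightarrow> 'a::metric_space set \<Rightarrow> ennreal" where
  "hausdorff1_pre \<delta> A =
     (INF C\<in>{C :: nat \<Rightarrow> 'a set. A \<subseteq> (\<Union>i. C i) \<and> (\<forall>i. bounded (C i) \<and> diameter (C i) \<le> \<delta>)}.
        \<Sum>i. ennreal (diameter (C i)))"

definition hausdorff1_outer :: "'a::metric_space set \<Rightarrow> ennreal" where
  "hausdorff1_outer A = (SUP \<delta>\<in>{0<..}. hausdorff1_pre \<delta> A)"

text \<open>The measure lives on all Caratheodory-measurable sets, hence it is complete and functions
  given only almost everywhere on a curve may be integrated. The lemmas \<open>emeasure_hausdorff1\<close> and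
  \<open>borel_sets_hausdorff1\<close> below confirm that the fallback clauses of \<^const>\<open>measure_of\<close> do not apply
  and that Borel sets are measurable.\<close>

definition hausdorff1 :: "'a::metric_space measure" where
  "hausdorff1 = measure_of UNIV (lambda_system UNIV (Pow UNIV) hausdorff1_outer) hausdorff1_outer"

lemma hausdorff1_pre_antimono: "\<delta> \<le> \<epsilon> \<Longrightarrow> hausdorff1_pre \<epsilon> A \<le> hausdorff1_pre \<delta> A"
  unfolding hausdorff1_pre_def by (rule INF_superset_mono) (auto intro: order_trans)

lemma hausdorff1_pre_mono: "A \<subseteq> B \<Longrightarrow> hausdorff1_pre \<delta> A \<le> hausdorff1_pre \<delta> B"
  unfolding hausdorff1_pre_def by (rule INF_superset_mono) auto

lemma hausdorff1_pre_le: "\<delta> > 0 \<Longrightarrow> hausdorff1_pre \<delta> A \<le> hausdorff1_outer A"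
  unfolding hausdorff1_outer_def by (rule SUP_upper) auto

lemma hausdorff1_outer_mono: "A \<subseteq> B \<Longrightarrow> hausdorff1_outer A \<le> hausdorff1_outer B"
  unfolding hausdorff1_outer_def by (rule SUP_mono) (auto intro: hausdorff1_pre_mono)

lemma hausdorff1_outer_empty [simp]: "hausdorff1_outer {} = 0"
proof -
  have "hausdorff1_pre \<delta> ({} :: 'a set) = 0" if "\<delta> > 0" for \<delta>
  proof -
    have "hausdorff1_pre \<delta> ({} :: 'a set) \<le> (\<Sum>i. ennreal (diameter ({} :: 'a set)))"
      unfolding hausdorff1_pre_def
      by (rule INF_lower2[where i = "\<lambda>_. {}"]) (use that in auto)
    then show ?thesis by simp
  qed
  then show ?thesis
    unfolding hausdorff1_outer_def by (auto intro!: antisym SUP_least)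
qed

lemma hausdorff1_pre_UN_le: "hausdorff1_pre \<delta> (\<Union>n. A n) \<le> (\<Sum>n. hausdorff1_pre \<delta> (A n))"
proof (rule ennreal_le_epsilon)
  fix e :: real assume e: "0 < e" and fin: "(\<Sum>n. hausdorff1_pre \<delta> (A n)) < top"
  have lt: "hausdorff1_pre \<delta> (A n) < hausdorff1_pre \<delta> (A n) + e * (1/2) ^ Suc n" for n
    using fin e by (auto simp add: less_top dest!: ennreal_suminf_lessD)
  then have "\<exists>C. (A n \<subseteq> (\<Union>i. C i) \<and> (\<forall>i. bounded (C i) \<and> diameter (C i) \<le> \<delta>)) \<and>
      (\<Sum>i. ennreal (diameter (C i))) < hausdorff1_pre \<delta> (A n) + e * (1/2) ^ Suc n" for n
    using iffD1[OF INF_less_iff, OF lt[of n, THEN eq_refl[OF hausdorff1_pre_def[symmetric], THEN le_less_trans]]]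
    by auto
  then obtain B where B: "\<And>n. A n \<subseteq> (\<Union>i. B n i)"
      "\<And>n i. bounded (B n i) \<and> diameter (B n i) \<le> \<delta>"
      "\<And>n. (\<Sum>i. ennreal (diameter (B n i))) < hausdorff1_pre \<delta> (A n) + e * (1/2) ^ Suc n"
    by metis
  define C where "C = case_prod B o prod_decode"
  have A_C: "(\<Union>i. A i) \<subseteq> (\<Union>i. C i)"
    using B(1) by (auto simp add: C_def subset_eq) (metis prod.case prod_encode_inverse)
  have "hausdorff1_pre \<delta> (\<Union>n. A n) \<le> (\<Sum>i. ennreal (diameter (C i)))"
    unfolding hausdorff1_pre_def
    by (rule INF_lower) (use A_C B(2) in \<open>auto simp: C_def split: prod.split\<close>)
  also have "\<dots> = (\<Sum>n. \<Sum>i. ennreal (diameter (B n i)))"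
    unfolding C_def comp_def
    using suminf_ennreal_2dimen[where f = "\<lambda>(n, i). ennreal (diameter (B n i))"
        and g = "\<lambda>n. \<Sum>i. ennreal (diameter (B n i))"]
    by (auto simp: comp_def split_def)
  also have "\<dots> \<le> (\<Sum>n. hausdorff1_pre \<delta> (A n) + ennreal e * ennreal ((1/2) ^ Suc n))"
    using B(3) e by (intro suminf_le allI)
      (auto simp flip: ennreal_mult intro: less_imp_le)
  also have "\<dots> = (\<Sum>n. hausdorff1_pre \<delta> (A n)) + (\<Sum>n. ennreal e * ennreal ((1/2) ^ Suc n))"
    by (rule suminf_add[symmetric]) auto
  also have "\<dots> = (\<Sum>n. hausdorff1_pre \<delta> (A n)) + e"
    unfolding ennreal_suminf_cmult
    by (subst suminf_ennreal_eq[OF zero_le_power power_half_series]) auto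
  finally show "hausdorff1_pre \<delta> (\<Union>n. A n) \<le> (\<Sum>n. hausdorff1_pre \<delta> (A n)) + e" .
qed

lemma hausdorff1_outer_UN_le: "hausdorff1_outer (\<Union>n. A n) \<le> (\<Sum>n. hausdorff1_outer (A n))"
  unfolding hausdorff1_outer_def[of "\<Union>n. A n"]
proof (rule SUP_least)
  fix \<delta> :: real assume "\<delta> \<in> {0<..}"
  then show "hausdorff1_pre \<delta> (\<Union>n. A n) \<le> (\<Sum>n. hausdorff1_outer (A n))"
    by (intro order_trans[OF hausdorff1_pre_UN_le] suminf_le) (auto intro: hausdorff1_pre_le)
qed

lemma hausdorff1_outer_Un_le: "hausdorff1_outer (A \<union> B) \<le> hausdorff1_outer A + hausdorff1_outer B"
proof -
  have "hausdorff1_outer (\<Union>n. if n = 0 then A else if n = Suc 0 then B else {})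
      \<le> (\<Sum>n. hausdorff1_outer (if n = 0 then A else if n = Suc 0 then B else {}))"
    by (rule hausdorff1_outer_UN_le)
  also have "\<dots> = (\<Sum>n\<in>{0, Suc 0}. hausdorff1_outer (if n = 0 then A else if n = Suc 0 then B else {}))"
    by (rule suminf_finite) auto
  also have "(\<Union>n. if n = (0::nat) then A else if n = Suc 0 then B else {}) = A \<union> B"
    by (auto split: if_splits)
  finally show ?thesis by simp
qed

lemma outer_measure_space_hausdorff1: "outer_measure_space (Pow UNIV) hausdorff1_outer"
  by (auto simp: outer_measure_space_def positive_def increasing_def countably_subadditive_def
      intro: hausdorff1_outer_mono hausdorff1_outer_UN_le)

lemma measure_space_hausdorff1:
  "measure_space UNIV (lambda_system UNIV (Pow UNIV) hausdorff1_outer) hausdorff1_outer"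
  using sigma_algebra.caratheodory_lemma[OF sigma_algebra_Pow outer_measure_space_hausdorff1] .

lemma space_hausdorff1 [simp]: "space hausdorff1 = UNIV"
  by (simp add: hausdorff1_def space_measure_of_conv)

lemma sets_hausdorff1: "sets hausdorff1 = lambda_system UNIV (Pow UNIV) hausdorff1_outer"
  using measure_space_hausdorff1 unfolding hausdorff1_def measure_space_def
  by (subst sets_measure_of) (auto dest!: sigma_algebra.sigma_sets_eq)

lemma emeasure_hausdorff1: "A \<in> sets hausdorff1 \<Longrightarrow> emeasure hausdorff1 A = hausdorff1_outer A"
  using measure_space_hausdorff1 unfolding sets_hausdorff1
  by (intro emeasure_measure_of[OF hausdorff1_def])
     (auto simp: measure_space_def sets_hausdorff1)

lemma hausdorff1_outer_separated:
  assumes d: "d > 0" and sep: "\<And>x y. x \<in> A \<Longrightarrow> y \<in> B \<Longrightarrow> d \<le> dist x y"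
  shows "hausdorff1_outer A + hausdorff1_outer B \<le> hausdorff1_outer (A \<union> B)"
proof -
  have pre: "hausdorff1_pre \<delta> A + hausdorff1_pre \<delta> B \<le> hausdorff1_pre \<delta> (A \<union> B)" if "\<delta> < d" for \<delta>
    unfolding hausdorff1_pre_def[of \<delta> "A \<union> B"]
  proof (rule INF_greatest, safe)
    fix C :: "nat \<Rightarrow> 'a set"
    assume C: "A \<union> B \<subseteq> (\<Union>i. C i)" and b: "\<forall>i. bounded (C i) \<and> diameter (C i) \<le> \<delta>"
    define P where "P S i = (if C i \<inter> S = {} then {} else C i)" for S i
    have \<delta>0: "0 \<le> \<delta>"
      using b diameter_ge_0[of "C 0"] by (meson order_trans)
    have le: "hausdorff1_pre \<delta> S \<le> (\<Sum>i. ennreal (diameter (P S i)))" if S: "S \<subseteq> (\<Union>i. C i)" for S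
      unfolding hausdorff1_pre_def
    proof (rule INF_lower, safe)
      fix x assume x: "x \<in> S"
      then obtain i where "x \<in> C i" using S by blast
      then show "x \<in> (\<Union>i. P S i)" using x by (auto simp: P_def)
    qed (use b \<delta>0 in \<open>auto simp: P_def\<close>)
    have one: "diameter (P A i) + diameter (P B i) \<le> diameter (C i)" for i
    proof (cases "C i \<inter> A = {} \<or> C i \<inter> B = {}")
      case True
      then show ?thesis using b diameter_ge_0[of "C i"] by (auto simp: P_def)
    next
      case False
      then obtain x y where "x \<in> C i" "x \<in> A" "y \<in> C i" "y \<in> B" by auto
      then have "d \<le> diameter (C i)"
        using sep diameter_bounded_bound[of "C i" x y] b by fastforce
      then show ?thesis using b that by (meson not_less order_trans)
    qed
    have "hausdorff1_pre \<delta> A + hausdorff1_pre \<delta> B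
        \<le> (\<Sum>i. ennreal (diameter (P A i))) + (\<Sum>i. ennreal (diameter (P B i)))"
      using C by (intro add_mono le) auto
    also have "\<dots> = (\<Sum>i. ennreal (diameter (P A i)) + ennreal (diameter (P B i)))"
      by (rule suminf_add) auto
    also have "\<dots> \<le> (\<Sum>i. ennreal (diameter (C i)))"
      using one b by (intro suminf_le)
        (auto simp: P_def diameter_ge_0 simp flip: ennreal_plus intro!: ennreal_leI)
    finally show "hausdorff1_pre \<delta> A + hausdorff1_pre \<delta> B \<le> (\<Sum>i. ennreal (diameter (C i)))" .
  qed
  have "hausdorff1_outer A + hausdorff1_outer B
      = (SUP \<delta>\<in>{0<..}. hausdorff1_pre \<delta> A + hausdorff1_pre \<delta> B)"
    unfolding hausdorff1_outer_def
  proof (rule SUP_add_directed_ennreal[symmetric])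
    fix i j :: real assume "i \<in> {0<..}" "j \<in> {0<..}"
    then show "\<exists>k\<in>{0<..}. hausdorff1_pre i A + hausdorff1_pre j B \<le> hausdorff1_pre k A + hausdorff1_pre k B"
      by (intro bexI[of _ "min i j"] add_mono hausdorff1_pre_antimono) auto
  qed
  also have "\<dots> \<le> hausdorff1_outer (A \<union> B)"
  proof (rule SUP_least)
    fix \<delta> :: real assume \<delta>: "\<delta> \<in> {0<..}"
    define k where "k = min \<delta> (d / 2)"
    have k: "k > 0" "k < d" "k \<le> \<delta>" using \<delta> d by (auto simp: k_def)
    have "hausdorff1_pre \<delta> A + hausdorff1_pre \<delta> B \<le> hausdorff1_pre k A + hausdorff1_pre k B"
      by (intro add_mono hausdorff1_pre_antimono k)
    also have "\<dots> \<le> hausdorff1_pre k (A \<union> B)" by (rule pre) (rule k)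
    also have "\<dots> \<le> hausdorff1_outer (A \<union> B)" by (rule hausdorff1_pre_le) (rule k)
    finally show "hausdorff1_pre \<delta> A + hausdorff1_pre \<delta> B \<le> hausdorff1_outer (A \<union> B)" .
  qed
  finally show ?thesis .
qed

lemma closed_in_sets_hausdorff1:
  fixes F :: "'a::metric_space set"
  assumes "closed F"
  shows "F \<in> sets hausdorff1"
proof (cases "F = {}")
  case False
  let ?H = "hausdorff1_outer :: 'a set \<Rightarrow> ennreal"
  have "?H (X \<inter> F) + ?H (X - F) \<le> ?H X" for X
  proof (cases "?H X = top")
    case fin: False
    define D where "D n = {x \<in> X. 1 / real (Suc n) \<le> infdist x F}" for n
    define R where "R n = D (Suc n) - D n" for n
    have gap: "1 / real (Suc (Suc n)) < 1 / real (Suc n)" for n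
      by (simp add: frac_less2)
    have dist: "a - b \<le> dist x y" if "a \<le> infdist x F" "infdist y F \<le> b" for a b x y
      using infdist_triangle[of x F y] that by linarith
    have Dmono: "D n \<subseteq> D (Suc n)" for n
      using gap[of n] by (auto simp: D_def)
    have DX: "D n \<subseteq> X" for n by (auto simp: D_def)
    have RD: "?H (D n) + ?H (R (Suc n)) \<le> ?H (D (Suc (Suc n)))" for n
    proof -
      have "?H (D n) + ?H (R (Suc n)) \<le> ?H (D n \<union> R (Suc n))"
      proof (rule hausdorff1_outer_separated)
        show "1 / real (Suc n) - 1 / real (Suc (Suc n)) > 0" using gap[of n] by simp
        fix x y assume "x \<in> D n" "y \<in> R (Suc n)"
        then show "1 / real (Suc n) - 1 / real (Suc (Suc n)) \<le> dist x y"
          by (intro dist) (auto simp: D_def R_def)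
      qed
      also have "\<dots> \<le> ?H (D (Suc (Suc n)))"
        using Dmono[of n] Dmono[of "Suc n"] by (intro hausdorff1_outer_mono) (auto simp: R_def)
      finally show ?thesis .
    qed
    have sumR: "(\<Sum>i<n. ?H (R (Suc i))) \<le> ?H (D (Suc n)) + ?H (D n)" for n
    proof (induction n)
      case (Suc n)
      have "(\<Sum>i<Suc n. ?H (R (Suc i))) \<le> (?H (D (Suc n)) + ?H (D n)) + ?H (R (Suc n))"
        using Suc by (auto intro: add_right_mono)
      also have "\<dots> = ?H (D (Suc n)) + (?H (D n) + ?H (R (Suc n)))" by (simp add: ac_simps)
      also have "\<dots> \<le> ?H (D (Suc n)) + ?H (D (Suc (Suc n)))" by (intro add_left_mono RD)
      finally show ?case by (simp add: ac_simps)
    qed simp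
    have "(\<Sum>i. ?H (R (Suc i))) \<le> ?H X + ?H X"
    proof (rule suminf_le_const[OF summableI])
      fix n
      show "(\<Sum>i<n. ?H (R (Suc i))) \<le> ?H X + ?H X"
        by (rule order_trans[OF sumR]) (intro add_mono hausdorff1_outer_mono DX)
    qed
    then have finsum: "(\<Sum>i. ?H (R (Suc i))) \<noteq> top"
      using fin by (auto simp: top_unique)
    have tail: "(\<lambda>n. \<Sum>i. ?H (R (Suc (i + n)))) \<longlonglongrightarrow> 0"
    proof -
      define r where "r i = enn2real (?H (R (Suc i)))" for i
      have r: "?H (R (Suc i)) = ennreal (r i)" for i
        using ennreal_suminf_lessD[of "\<lambda>i. ?H (R (Suc i))" top i] finsum
        by (simp add: r_def less_top)
      have r0: "r i \<ge> 0" for i by (simp add: r_def)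
      have s: "summable r"
        using finsum r0 by (intro summable_suminf_not_top) (auto simp: r)
      have "(\<Sum>i. ?H (R (Suc (i + n)))) = ennreal (\<Sum>i. r (i + n))" for n
        using r0 s by (auto simp: r intro!: suminf_ennreal2 summable_ignore_initial_segment)
      moreover have "(\<lambda>n. \<Sum>i. r (i + n)) \<longlonglongrightarrow> 0"
        by (rule suminf_exist_split2[OF s])
      ultimately show ?thesis
        using tendsto_ennrealI by fastforce
    qed
    have bound: "?H (X \<inter> F) + ?H (X - F) \<le> ?H X + (\<Sum>i. ?H (R (Suc (i + n))))" for n
    proof -
      have "X - F \<subseteq> D (Suc n) \<union> (\<Union>i. R (Suc (i + n)))"
      proof
        fix x assume x: "x \<in> X - F"
        then have "infdist x F > 0"
          using assms False in_closed_iff_infdist_zero[of F x] infdist_nonneg[of x F] by force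
        then obtain m where "inverse (real (Suc m)) < infdist x F"
          using reals_Archimedean by blast
        then have "\<exists>m. x \<in> D m" using x by (auto simp: D_def inverse_eq_divide intro: less_imp_le)
        define m where "m = (LEAST m. x \<in> D m)"
        have m: "x \<in> D m" "\<And>k. k < m \<Longrightarrow> x \<notin> D k"
          using \<open>\<exists>m. x \<in> D m\<close> by (auto simp: m_def intro: LeastI_ex dest: not_less_Least)
        show "x \<in> D (Suc n) \<union> (\<Union>i. R (Suc (i + n)))"
        proof (cases "m \<le> Suc n")
          case True
          then have "D m \<subseteq> D (Suc n)" using Dmono lift_Suc_mono_le[of D] by blast
          then show ?thesis using m by auto
        next
          case f: False
          then obtain i where i: "m = Suc (Suc (i + n))"
            by (metis add.commute less_natE not_le add_Suc_right)
          have "x \<in> R (Suc (i + n))" using m(1) m(2)[of "Suc (i + n)"] i by (auto simp: R_def)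
          then show ?thesis by auto
        qed
      qed
      then have "?H (X - F) \<le> ?H (D (Suc n) \<union> (\<Union>i. R (Suc (i + n))))"
        by (rule hausdorff1_outer_mono)
      also have "\<dots> \<le> ?H (D (Suc n)) + (\<Sum>i. ?H (R (Suc (i + n))))"
        by (rule order_trans[OF hausdorff1_outer_Un_le]) (intro add_left_mono hausdorff1_outer_UN_le)
      finally have "?H (X \<inter> F) + ?H (X - F)
          \<le> (?H (X \<inter> F) + ?H (D (Suc n))) + (\<Sum>i. ?H (R (Suc (i + n))))"
        by (simp add: add.assoc add_left_mono)
      also have "?H (X \<inter> F) + ?H (D (Suc n)) \<le> ?H X"
      proof -
        have "?H (D (Suc n)) + ?H (X \<inter> F) \<le> ?H (D (Suc n) \<union> (X \<inter> F))"
        proof (rule hausdorff1_outer_separated)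
          show "1 / real (Suc (Suc n)) - 0 > 0" by simp
          fix x y assume "x \<in> D (Suc n)" "y \<in> X \<inter> F"
          then show "1 / real (Suc (Suc n)) - 0 \<le> dist x y"
            by (intro dist) (auto simp: D_def)
        qed
        also have "\<dots> \<le> ?H X" by (intro hausdorff1_outer_mono) (auto simp: D_def)
        finally show ?thesis by (simp add: add.commute)
      qed
      finally show ?thesis by (simp add: add_right_mono)
    qed
    have "(\<lambda>n. ?H X + (\<Sum>i. ?H (R (Suc (i + n))))) \<longlonglongrightarrow> ?H X + 0"
      by (intro tendsto_add tendsto_const tail)
    then show ?thesis
      using bound by (intro LIMSEQ_le_const[where X = "\<lambda>n. ?H X + (\<Sum>i. ?H (R (Suc (i + n))))"]) auto
  qed simp
  moreover have "?H X \<le> ?H (X \<inter> F) + ?H (X - F)" for X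
    using hausdorff1_outer_Un_le[of "X \<inter> F" "X - F"] by (simp add: Un_Diff_Int Un_commute Int_Diff_Un)
  ultimately show ?thesis
    unfolding sets_hausdorff1 algebra.lambda_system_eq[OF algebra_Pow] by (auto intro: antisym)
qed simp

lemma borel_sets_hausdorff1: "sets borel \<subseteq> sets (hausdorff1 :: 'a::metric_space measure)"
proof -
  have "sigma_sets UNIV (Collect closed) \<subseteq> sets (hausdorff1 :: 'a measure)"
    using sets.sigma_sets_subset[of "Collect closed" "hausdorff1 :: 'a measure"]
    by (auto intro: closed_in_sets_hausdorff1)
  then show ?thesis by (simp add: borel_eq_closed)
qed

section \<open>Square-integrable functions\<close>

definition square_integrable_on ::
    "'a measure \<Rightarrow> 'a set \<Rightarrow> ('a \<Rightarrow> 'b::{second_countable_topology, banach}) \<Rightarrow> bool" where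
  "square_integrable_on M A f \<longleftrightarrow>
     set_borel_measurable M A f \<and> set_integrable M A (\<lambda>x. (norm (f x))\<^sup>2)"

definition L2norm :: "'a measure \<Rightarrow> 'a set \<Rightarrow> ('a \<Rightarrow> 'b::real_normed_vector) \<Rightarrow> real" where
  "L2norm M A f = sqrt (LINT x:A|M. (norm (f x))\<^sup>2)"

section \<open>Classical derivatives in the plane\<close>

definition pderiv2 :: "2 \<Rightarrow> (plane \<Rightarrow> 'b::real_normed_vector) \<Rightarrow> plane \<Rightarrow> 'b" where
  "pderiv2 j w x = frechet_derivative w (at x) (axis j 1)"

definition C1_on :: "plane set \<Rightarrow> (plane \<Rightarrow> 'b::real_normed_vector) \<Rightarrow> bool" where
  "C1_on S w \<longleftrightarrow> (\<forall>x\<in>S. w differentiable (at x)) \<and> (\<forall>j. continuous_on S (pderiv2 j w))"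

definition C2_on :: "plane set \<Rightarrow> (plane \<Rightarrow> 'b::real_normed_vector) \<Rightarrow> bool" where
  "C2_on S w \<longleftrightarrow> C1_on S w \<and> (\<forall>j. C1_on S (pderiv2 j w))"

definition laplacian :: "(plane \<Rightarrow> 'b::real_normed_vector) \<Rightarrow> plane \<Rightarrow> 'b" where
  "laplacian w x = (\<Sum>j\<in>UNIV. pderiv2 j (pderiv2 j w) x)"

section \<open>Domains and outward unit normals\<close>

text \<open>\<open>T\<close> is the change to local coordinates, in which the domain is, near \<open>x\<close>, the set of points
  strictly above a Lipschitz graph.\<close>

definition lipschitz_domain :: "plane set \<Rightarrow> bool" where
  "lipschitz_domain \<Omega> \<longleftrightarrow> open \<Omega> \<and> connected \<Omega> \<and> \<Omega> \<noteq> {} \<and>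
     (\<forall>x\<in>frontier \<Omega>. \<exists>(T :: plane \<Rightarrow> plane) r L (\<phi> :: real \<Rightarrow> real).
        orthogonal_transformation T \<and> r > 0 \<and> L-lipschitz_on UNIV \<phi> \<and>
        (\<forall>y\<in>ball x r. y \<in> \<Omega> \<longleftrightarrow> \<phi> (T (y - x) $ 1) < T (y - x) $ 2))"

text \<open>Blowing \<open>K\<close> up at \<open>x\<close> gives the half plane with outward normal \<open>\<nu>\<close>.\<close>

definition is_outward_normal :: "plane set \<Rightarrow> plane \<Rightarrow> plane \<Rightarrow> bool" where
  "is_outward_normal K x \<nu> \<longleftrightarrow> norm \<nu> = 1 \<and>
     (\<forall>\<epsilon>>0. \<exists>\<delta>>0. \<forall>y\<in>ball x \<delta>.
        ((y - x) \<bullet> \<nu> < - \<epsilon> * norm (y - x) \<longrightarrow> y \<in> K) \<and>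
        ((y - x) \<bullet> \<nu> > \<epsilon> * norm (y - x) \<longrightarrow> y \<notin> K))"

definition outward_normal :: "plane set \<Rightarrow> plane \<Rightarrow> plane" where
  "outward_normal K x = (THE \<nu>. is_outward_normal K x \<nu>)"

section \<open>Traces\<close>

text \<open>Traces and normal derivatives on \<open>frontier K\<close> are the usual ones from Sobolev space theory,
  characterised by Green's formulas, for all \<open>\<phi>\<close> that are \<open>C\<^sup>1\<close> on the whole plane:
  \<open>\<integral>\<^sub>K \<phi> \<partial>\<^sub>jw + w \<partial>\<^sub>j\<phi> = \<integral>\<^bsub>\<partial>K\<^esub> \<phi> t n\<^sub>j\<close> and \<open>\<integral>\<^sub>K \<nabla>w \<cdot> \<nabla>\<phi> + \<phi> \<Delta>w = \<integral>\<^bsub>\<partial>K\<^esub> \<phi> s\<close>,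
  and required to lie in \<open>L\<^sup>2(\<partial>K)\<close>. They are determined up to null sets of the arc-length measure.
  A function that is smooth up to the boundary has its restriction as trace \<open>t\<close>, and the normal
  component of its gradient as \<open>s\<close>.\<close>

definition is_trace :: "plane set \<Rightarrow> (plane \<Rightarrow> complex) \<Rightarrow> (plane \<Rightarrow> complex) \<Rightarrow> bool" where
  "is_trace K w t \<longleftrightarrow> square_integrable_on hausdorff1 (frontier K) t \<and>
     (\<forall>\<phi> :: plane \<Rightarrow> real. \<forall>j. C1_on UNIV \<phi> \<longrightarrow>
        (LINT y:K|lebesgue. \<phi> y *\<^sub>R pderiv2 j w y + pderiv2 j \<phi> y *\<^sub>R w y) =
        (LINT x:frontier K|hausdorff1. (\<phi> x * outward_normal K x $ j) *\<^sub>R t x))"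

definition is_normal_derivative :: "plane set \<Rightarrow> (plane \<Rightarrow> complex) \<Rightarrow> (plane \<Rightarrow> complex) \<Rightarrow> bool" where
  "is_normal_derivative K w s \<longleftrightarrow> square_integrable_on hausdorff1 (frontier K) s \<and>
     (\<forall>\<phi> :: plane \<Rightarrow> real. C1_on UNIV \<phi> \<longrightarrow>
        (LINT y:K|lebesgue. (\<Sum>j\<in>UNIV. pderiv2 j \<phi> y *\<^sub>R pderiv2 j w y) + \<phi> y *\<^sub>R laplacian w y) =
        (LINT x:frontier K|hausdorff1. \<phi> x *\<^sub>R s x))"

definition trace_on :: "plane set \<Rightarrow> (plane \<Rightarrow> complex) \<Rightarrow> plane \<Rightarrow> complex" where
  "trace_on K w = (SOME t. is_trace K w t)"

definition normal_derivative :: "plane set \<Rightarrow> (plane \<Rightarrow> complex) \<Rightarrow> plane \<Rightarrow> complex" where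
  "normal_derivative K w = (SOME s. is_normal_derivative K w s)"

section \<open>Helmholtz fields\<close>

text \<open>Finite-energy solutions of the Helmholtz equation whose Cauchy data are square integrable.
  Classical differentiability in the open set \<open>K\<close> is no restriction, by interior regularity.\<close>

definition helmholtz_field :: "real \<Rightarrow> plane set \<Rightarrow> (plane \<Rightarrow> complex) \<Rightarrow> bool" where
  "helmholtz_field \<kappa> K w \<longleftrightarrow>
     C2_on K w \<and> (\<forall>x\<in>K. laplacian w x + of_real (\<kappa>\<^sup>2) * w x = 0) \<and>
     square_integrable_on lebesgue K w \<and> (\<forall>j. square_integrable_on lebesgue K (pderiv2 j w)) \<and>
     (\<exists>t. is_trace K w t) \<and> (\<exists>s. is_normal_derivative K w s)"

definition broken_trefftz :: "real \<Rightarrow> plane set set \<Rightarrow> (plane \<Rightarrow> complex) \<Rightarrow> bool" where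
  "broken_trefftz \<kappa> \<T> w \<longleftrightarrow> (\<forall>K\<in>\<T>. helmholtz_field \<kappa> K w)"

section \<open>Meshes\<close>

text \<open>No shape or Lipschitz condition is imposed on the elements, only what is needed to speak
  about \<open>n\<^sup>\<plusminus>\<close>: boundaries of finite length with an outward unit normal almost everywhere.\<close>

definition mesh_of :: "plane set \<Rightarrow> plane set set \<Rightarrow> bool" where
  "mesh_of \<Omega> \<T> \<longleftrightarrow> finite \<T> \<and> disjoint \<T> \<and> (\<Union>K\<in>\<T>. closure K) = closure \<Omega> \<and>
     (\<forall>K\<in>\<T>. open K \<and> connected K \<and> K \<noteq> {} \<and> K \<subseteq> \<Omega> \<and>
        emeasure hausdorff1 (frontier K) < \<infinity> \<and>
        (AE x in hausdorff1. x \<in> frontier K \<longrightarrow> (\<exists>\<nu>. is_outward_normal K x \<nu>)))"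

text \<open>An interior edge is represented by the unordered pair \<open>p = {K\<^sup>+, K\<^sup>-}\<close> of its neighbours;
  as a point set it is \<open>edge p\<close>.\<close>

definition edge :: "plane set set \<Rightarrow> plane set" where
  "edge p = (\<Inter>K\<in>p. frontier K)"

definition interior_edges :: "plane set set \<Rightarrow> plane set set set" where
  "interior_edges \<T> = {p. \<exists>K\<in>\<T>. \<exists>K'\<in>\<T>. K \<noteq> K' \<and> p = {K, K'} \<and> emeasure hausdorff1 (edge p) > 0}"

text \<open>For \<open>p = {K\<^sup>+, K\<^sup>-}\<close> these are \<open>v\<^sup>+n\<^sup>+ + v\<^sup>-n\<^sup>-\<close> and \<open>\<nabla>v\<^sup>+ \<cdot> n\<^sup>+ + \<nabla>v\<^sup>- \<cdot> n\<^sup>-\<close>; each normal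
  derivative already contains the outward normal of its own element.\<close>

definition jump :: "plane set set \<Rightarrow> (plane \<Rightarrow> complex) \<Rightarrow> plane \<Rightarrow> complex^2" where
  "jump p v x = (\<Sum>K\<in>p. \<chi> j. (outward_normal K x $ j) *\<^sub>R trace_on K v x)"

definition normal_jump_grad :: "plane set set \<Rightarrow> (plane \<Rightarrow> complex) \<Rightarrow> plane \<Rightarrow> complex" where
  "normal_jump_grad p v x = (\<Sum>K\<in>p. normal_derivative K v x)"

text \<open>Almost every point of \<open>\<partial>\<Omega>\<close> lies on the boundary of exactly one element \<open>K\<close>, and there the
  outward normals of \<open>K\<close> and \<open>\<Omega>\<close> agree.\<close>

definition boundary_element :: "plane set set \<Rightarrow> plane \<Rightarrow> plane set" where
  "boundary_element \<T> x = (SOME K. K \<in> \<T> \<and> x \<in> frontier K)"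

definition boundary_trace :: "plane set set \<Rightarrow> (plane \<Rightarrow> complex) \<Rightarrow> plane \<Rightarrow> complex" where
  "boundary_trace \<T> v x = trace_on (boundary_element \<T> x) v x"

definition boundary_normal_derivative :: "plane set set \<Rightarrow> (plane \<Rightarrow> complex) \<Rightarrow> plane \<Rightarrow> complex" where
  "boundary_normal_derivative \<T> v x = normal_derivative (boundary_element \<T> x) v x"

section \<open>Skeleton residual and stability\<close>

definition skeleton_residual ::
    "real \<Rightarrow> plane set set \<Rightarrow> plane set \<Rightarrow> plane set \<Rightarrow> (plane \<Rightarrow> complex) \<Rightarrow> real \<Rightarrow> real
      \<Rightarrow> (plane \<Rightarrow> complex) \<Rightarrow> real" where
  "skeleton_residual \<kappa> \<T> \<Gamma>D \<Gamma>R g \<alpha> \<beta> v =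
     (\<Sum>p\<in>interior_edges \<T>. LINT x:edge p|hausdorff1.
        \<alpha> * \<kappa> * (norm (jump p v x))\<^sup>2 + \<beta> / \<kappa> * (norm (normal_jump_grad p v x))\<^sup>2)
     + \<alpha> * \<kappa> * (LINT x:\<Gamma>D|hausdorff1. (norm (boundary_trace \<T> v x - g x))\<^sup>2)
     + 1 / (2 * \<kappa>) * (LINT x:\<Gamma>R|hausdorff1.
         (norm (boundary_normal_derivative \<T> v x + \<i> * of_real \<kappa> * boundary_trace \<T> v x))\<^sup>2)"

definition stability_estimate ::
    "real \<Rightarrow> plane set \<Rightarrow> plane set set \<Rightarrow> plane set \<Rightarrow> plane set \<Rightarrow> real \<Rightarrow> bool" where
  "stability_estimate \<kappa> \<Omega> \<T> \<Gamma>D \<Gamma>R Cstab \<longleftrightarrow> (\<forall>w. broken_trefftz \<kappa> \<T> w \<longrightarrow>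
     L2norm lebesgue \<Omega> w \<le> Cstab * sqrt (
       (\<Sum>p\<in>interior_edges \<T>.
          \<kappa> * (L2norm hausdorff1 (edge p) (jump p w))\<^sup>2
          + 1 / \<kappa> * (L2norm hausdorff1 (edge p) (normal_jump_grad p w))\<^sup>2)
       + \<kappa> * (L2norm hausdorff1 \<Gamma>D (boundary_trace \<T> w))\<^sup>2
       + 1 / \<kappa> * (L2norm hausdorff1 \<Gamma>R
           (\<lambda>x. boundary_normal_derivative \<T> w x + \<i> * of_real \<kappa> * boundary_trace \<T> w x))\<^sup>2))"

definition solves_helmholtz_bvp ::
    "real \<Rightarrow> plane set \<Rightarrow> plane set \<Rightarrow> plane set \<Rightarrow> (plane \<Rightarrow> complex) \<Rightarrow> (plane \<Rightarrow> complex) \<Rightarrow> bool" where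
  "solves_helmholtz_bvp \<kappa> \<Omega> \<Gamma>D \<Gamma>R g u \<longleftrightarrow> helmholtz_field \<kappa> \<Omega> u \<and>
     (AE x in hausdorff1. x \<in> \<Gamma>D \<longrightarrow> trace_on \<Omega> u x = g x) \<and>
     (AE x in hausdorff1. x \<in> \<Gamma>R \<longrightarrow>
        normal_derivative \<Omega> u x + \<i> * of_real \<kappa> * trace_on \<Omega> u x = 0)"

definition C_J :: "real \<Rightarrow> real \<Rightarrow> real" where
  "C_J \<alpha> \<beta> = sqrt (Max {inverse \<alpha>, inverse \<beta>, 2})"

end

theory Submission
  imports Defs
begin

text \<open>
  The error \<open>w = u - v\<close> is again elementwise Helmholtz, so the stability estimate bounds it by the norms of its
  jumps and boundary data. The exact solution \<open>u\<close> has no jumps and satisfies the boundary conditions; hence the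
  jumps of \<open>w\<close> are minus those of \<open>v\<close>, and its boundary data are minus the boundary residuals of \<open>v\<close>
  (\<open>error_skeleton_norms\<close>). The bound therefore contains the same norms as the skeleton residual of \<open>v\<close>,
  with the weights \<open>\<kappa>\<close>, \<open>1 / \<kappa>\<close>, \<open>\<kappa>\<close>, \<open>1 / \<kappa>\<close> in place of \<open>\<alpha> \<kappa>\<close>, \<open>\<beta> / \<kappa>\<close>, \<open>\<alpha> \<kappa>\<close>, \<open>1 / (2 \<kappa>)\<close>. The largest ratio of weights is
  \<open>max {1 / \<alpha>, 1 / \<beta>, 2}\<close>, the square of \<open>C_J \<alpha> \<beta>\<close>.

  The work lies in the words "no jumps" and "again", since traces and normal derivatives are only
  defined weakly, by Green's formula, and are chosen element by element. Three facts settle this.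

  First, an integrable density on a set of finite arc length that is orthogonal to all \<open>C\<^sup>1\<close> functions vanishes
  almost everywhere (\<open>integrable_zero_if_C1_test\<close>). Together with measurability of the normal
  (\<open>outward_normal_measurable\<close>) this makes traces unique and compatible with differences, up to null sets.

  Secondly, Green's formula for \<open>u\<close> on the domain is the sum of those on the elements, because boundaries of
  finite length have no area. By the first fact, the normal traces of \<open>u\<close> from all elements at a point add up
  to the normal trace from the domain, which is absent inside (\<open>AE_sum_traces\<close>,
  \<open>AE_sum_normal_derivatives\<close>).

  Thirdly, at almost every point of the skeleton the incident elements have normals, and disjoint
  elements have opposite ones. So at most two elements meet there, and on the boundary of the Lipschitz
  domain, which has an exterior cone, only one (\<open>good_point_elements_eq\<close>, \<open>good_point_boundary_unique\<close>). The sums thus reduce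
  to the jump on an edge, respectively to a single boundary trace.
\<close>

section \<open>Null sets and Borel hulls for arc length\<close>

lemma hausdorff1_outer_null_in_sets:
  assumes "hausdorff1_outer A = 0"
  shows "A \<in> sets hausdorff1"
proof -
  have "hausdorff1_outer (A \<inter> X) + hausdorff1_outer (X - A) = hausdorff1_outer X" for X
  proof (rule antisym)
    have "hausdorff1_outer (A \<inter> X) = 0"
      using hausdorff1_outer_mono[of "A \<inter> X" A] assms by auto
    then show "hausdorff1_outer (A \<inter> X) + hausdorff1_outer (X - A) \<le> hausdorff1_outer X"
      using hausdorff1_outer_mono[of "X - A" X] by auto
    have "(A \<inter> X) \<union> (X - A) = X" by auto
    then show "hausdorff1_outer X \<le> hausdorff1_outer (A \<inter> X) + hausdorff1_outer (X - A)"
      using hausdorff1_outer_Un_le[of "A \<inter> X" "X - A"] by simp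
  qed
  then show ?thesis
    unfolding sets_hausdorff1 algebra.lambda_system_eq[OF algebra_Pow]
    by (simp add: Int_commute)
qed

lemma complete_measure_hausdorff1: "complete_measure hausdorff1"
proof
  fix A B :: "'a set" assume "A \<subseteq> B" "B \<in> null_sets hausdorff1"
  then have "hausdorff1_outer A = 0"
    using hausdorff1_outer_mono[of A B] emeasure_hausdorff1[of B] by (auto simp: null_sets_def)
  then show "A \<in> sets hausdorff1" by (rule hausdorff1_outer_null_in_sets)
qed

text \<open>Normals, traces and the datum \<open>g\<close> are known only up to null sets. In a complete measure space
  a change on a null set does not affect measurability. Hence functions that agree almost everywhere
  have equal integrals in every case: if one of them is not measurable, neither is the other, and
  both integrals take the default value.\<close>

lemma (in complete_measure) borel_measurable_cong_AE_iff:
  fixes f g :: "'a \<Rightarrow> 'b::topological_space"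
  assumes "AE x in M. f x = g x"
  shows "f \<in> borel_measurable M \<longleftrightarrow> g \<in> borel_measurable M"
proof -
  have "g' \<in> borel_measurable M"
    if f': "f' \<in> borel_measurable M" and ae: "AE x in M. f' x = g' x" for f' g' :: "'a \<Rightarrow> 'b"
  proof (rule measurableI)
    fix B :: "'b set" assume B: "B \<in> sets borel"
    show "g' -` B \<inter> space M \<in> sets M"
    proof (rule in_sets_AE)
      show "f' -` B \<inter> space M \<in> sets M" using f' B by (rule measurable_sets)
      show "AE x in M. (x \<in> f' -` B \<inter> space M) = (x \<in> g' -` B \<inter> space M)"
        using ae by eventually_elim auto
    qed auto
  qed auto
  moreover have "AE x in M. g x = f x" using assms by eventually_elim simp
  ultimately show ?thesis using assms by blast
qed

lemma (in complete_measure) integrable_cong_AE_iff: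
  fixes f g :: "'a \<Rightarrow> 'b::{banach, second_countable_topology}"
  assumes "AE x in M. f x = g x"
  shows "integrable M f \<longleftrightarrow> integrable M g"
  using borel_measurable_cong_AE_iff[OF assms] assms
  by (auto dest: borel_measurable_integrable intro: integrable_cong_AE[THEN iffD1] integrable_cong_AE[THEN iffD2])

lemma (in complete_measure) integral_cong_AE_complete:
  fixes f g :: "'a \<Rightarrow> 'b::{banach, second_countable_topology}"
  assumes "AE x in M. f x = g x"
  shows "integral\<^sup>L M f = integral\<^sup>L M g"
proof (cases "f \<in> borel_measurable M")
  case True
  then show ?thesis using borel_measurable_cong_AE_iff[OF assms] assms
    by (intro integral_cong_AE) auto
next
  case False
  then have "g \<notin> borel_measurable M" using borel_measurable_cong_AE_iff[OF assms] by simp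
  with False show ?thesis
    by (metis borel_measurable_integrable not_integrable_integral_eq)
qed

lemma (in complete_measure) set_integrable_cong_AE_iff:
  fixes f g :: "'a \<Rightarrow> 'b::{banach, second_countable_topology}"
  assumes "AE x in M. x \<in> A \<longrightarrow> f x = g x"
  shows "set_integrable M A f \<longleftrightarrow> set_integrable M A g"
  unfolding set_integrable_def
  by (rule integrable_cong_AE_iff) (use assms in eventually_elim, auto simp: indicator_def)

lemma (in complete_measure) set_integral_cong_AE_complete:
  fixes f g :: "'a \<Rightarrow> 'b::{banach, second_countable_topology}"
  assumes "AE x in M. x \<in> A \<longrightarrow> f x = g x"
  shows "(LINT x:A|M. f x) = (LINT x:A|M. g x)"
  unfolding set_lebesgue_integral_def
  by (rule integral_cong_AE_complete) (use assms in eventually_elim, auto simp: indicator_def)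

lemma (in complete_measure) set_borel_measurable_cong_AE_iff:
  fixes f g :: "'a \<Rightarrow> 'b::real_normed_vector"
  assumes "AE x in M. x \<in> A \<longrightarrow> f x = g x"
  shows "set_borel_measurable M A f \<longleftrightarrow> set_borel_measurable M A g"
  unfolding set_borel_measurable_def
  by (rule borel_measurable_cong_AE_iff) (use assms in eventually_elim, auto simp: indicator_def)

lemma hausdorff1_pre_closed_cover:
  fixes A :: "'a::metric_space set"
  assumes "hausdorff1_pre \<delta> A < c"
  obtains C where "A \<subseteq> (\<Union>i::nat. C i)" "\<And>i. closed (C i)" "\<And>i. bounded (C i)"
    "\<And>i. diameter (C i) \<le> \<delta>" "(\<Sum>i. ennreal (diameter (C i))) < c"
proof -
  obtain C where "A \<subseteq> (\<Union>i::nat. C i)" "\<forall>i. bounded (C i) \<and> diameter (C i) \<le> \<delta>"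
      "(\<Sum>i. ennreal (diameter (C i))) < c"
    using assms unfolding hausdorff1_pre_def INF_less_iff by auto
  then show ?thesis
    using closure_subset
    by (intro that[of "\<lambda>i. closure (C i)"]) (auto simp: diameter_closure, blast)
qed

text \<open>Passing to closures does not change diameters, so near-optimal covers may be taken closed; the
  intersection of countably many of them, of vanishing mesh size, is a Borel hull of the same
  arc length.\<close>

lemma hausdorff1_borel_hull:
  fixes A :: "'a::metric_space set"
  assumes fin: "hausdorff1_outer A < \<infinity>"
  obtains B where "B \<in> sets borel" "A \<subseteq> B" "hausdorff1_outer B = hausdorff1_outer A"
proof -
  define \<delta> where "\<delta> n = 1 / real (Suc n)" for n
  have \<delta>: "\<delta> n > 0" for n by (simp add: \<delta>_def)
  have "\<exists>C. A \<subseteq> (\<Union>i::nat. C i) \<and> (\<forall>i. closed (C i) \<and> bounded (C i) \<and> diameter (C i) \<le> \<delta> n) \<and>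
      (\<Sum>i. ennreal (diameter (C i))) < hausdorff1_outer A + ennreal (\<delta> n)" for n
  proof -
    have "hausdorff1_outer A < hausdorff1_outer A + ennreal (\<delta> n)"
      using \<delta>[of n] fin by (simp add: ennreal_less_zero_iff less_top)
    then have "hausdorff1_pre (\<delta> n) A < hausdorff1_outer A + ennreal (\<delta> n)"
      using hausdorff1_pre_le[OF \<delta>, of n A] by (rule le_less_trans[rotated])
    then show ?thesis by (rule hausdorff1_pre_closed_cover) blast
  qed
  then obtain C where C: "\<And>n. A \<subseteq> (\<Union>i::nat. C n i)" "\<And>n i. closed (C n i)"
      "\<And>n i. bounded (C n i)" "\<And>n i. diameter (C n i) \<le> \<delta> n"
      "\<And>n. (\<Sum>i. ennreal (diameter (C n i))) < hausdorff1_outer A + ennreal (\<delta> n)"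
    by metis
  define B where "B = (\<Inter>n. \<Union>i. C n i)"
  have "hausdorff1_outer B \<le> hausdorff1_outer A"
    unfolding hausdorff1_outer_def[of B]
  proof (rule SUP_least)
    fix e :: real assume "e \<in> {0<..}"
    have le: "hausdorff1_pre e B \<le> hausdorff1_outer A + ennreal (\<delta> n)" if "\<delta> n \<le> e" for n
    proof -
      have "hausdorff1_pre e B \<le> hausdorff1_pre (\<delta> n) B" by (rule hausdorff1_pre_antimono[OF that])
      also have "\<dots> \<le> (\<Sum>i. ennreal (diameter (C n i)))"
        unfolding hausdorff1_pre_def by (rule INF_lower) (use C in \<open>auto simp: B_def\<close>)
      also have "\<dots> \<le> hausdorff1_outer A + ennreal (\<delta> n)" using C(5)[of n] by simp
      finally show ?thesis .
    qed
    have lim0: "\<delta> \<longlonglongrightarrow> 0" unfolding \<delta>_def using LIMSEQ_Suc[OF lim_1_over_n] .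
    have "(\<lambda>n. hausdorff1_outer A + ennreal (\<delta> n)) \<longlonglongrightarrow> hausdorff1_outer A + ennreal 0"
      by (intro tendsto_add tendsto_const tendsto_ennrealI lim0)
    moreover have "eventually (\<lambda>n. \<delta> n \<le> e) sequentially"
      using order_tendstoD(2)[OF lim0, of e] \<open>e \<in> {0<..}\<close> by (auto elim: eventually_mono)
    ultimately show "hausdorff1_pre e B \<le> hausdorff1_outer A"
      using le by (intro tendsto_lowerbound[where F = sequentially]) (auto elim: eventually_mono)
  qed
  moreover have "A \<subseteq> B" using C(1) by (auto simp: B_def)
  moreover have "B \<in> sets borel" unfolding B_def using C(2) by (intro sets.countable_INT'') auto
  ultimately show ?thesis using that hausdorff1_outer_mono[of A B] by (metis antisym)
qed

text \<open>A cover by sets of diameters \<open>d\<^sub>i \<le> \<delta>\<close> with \<open>\<Sum>d\<^sub>i\<close> bounded is contained in disks of total area at most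
  a constant times \<open>\<Sum>d\<^sub>i\<^sup>2 \<le> \<delta> \<Sum>d\<^sub>i\<close>, which tends to zero. Hence the skeleton of a mesh may be ignored in
  integrals over the domain.\<close>

lemma hausdorff1_finite_imp_lebesgue_null:
  fixes A :: "plane set"
  assumes fin: "hausdorff1_outer A < \<infinity>"
  shows "A \<in> null_sets lebesgue"
proof -
  define V where "V = unit_ball_vol (real DIM(plane))"
  obtain h where h: "hausdorff1_outer A = ennreal h" "h \<ge> 0" using fin by (cases "hausdorff1_outer A") auto
  have V: "V > 0" by (simp add: V_def)
  have "negligible A"
    unfolding negligible_outer_le
  proof (intro allI impI)
    fix e :: real assume e: "e > 0"
    define \<delta> where "\<delta> = e / (V * (h + 1))"
    have \<delta>: "\<delta> > 0" using e h V by (simp add: \<delta>_def)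
    have "hausdorff1_pre \<delta> A < ennreal (h + 1)"
      using hausdorff1_pre_le[OF \<delta>, of A] h by (auto simp: ennreal_lessI intro: le_less_trans)
    then obtain C where C: "A \<subseteq> (\<Union>i::nat. C i)" "\<And>i. bounded (C i)"
      "\<And>i. diameter (C i) \<le> \<delta>" "(\<Sum>i. ennreal (diameter (C i))) < ennreal (h + 1)"
      by (rule hausdorff1_pre_closed_cover) blast
    define D where "D i = (if C i = {} then {} else cball (SOME x. x \<in> C i) (diameter (C i)))" for i
    have CD: "C i \<subseteq> D i" for i
    proof
      fix x assume x: "x \<in> C i"
      then have "(SOME x. x \<in> C i) \<in> C i" by (rule someI)
      then show "x \<in> D i"
        using diameter_bounded_bound[OF C(2)[of i] _ x] x by (auto simp: D_def)
    qed
    have [measurable]: "D i \<in> sets lebesgue" for i by (auto simp: D_def)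
    have eD: "emeasure lebesgue (D i) \<le> ennreal (V * \<delta>) * ennreal (diameter (C i))" for i
    proof -
      have d0: "0 \<le> diameter (C i)" by (rule diameter_ge_0[OF C(2)])
      have "emeasure lebesgue (D i) \<le> ennreal (V * diameter (C i) ^ 2)"
        using d0 by (auto simp: D_def V_def emeasure_cball)
      also have "\<dots> \<le> ennreal (V * \<delta> * diameter (C i))"
        using C(3)[of i] d0 V by (intro ennreal_leI) (auto simp: power2_eq_square mult_right_mono)
      also have "\<dots> = ennreal (V * \<delta>) * ennreal (diameter (C i))"
        using d0 V \<delta> by (simp add: ennreal_mult)
      finally show ?thesis .
    qed
    have "emeasure lebesgue (\<Union>i. D i) \<le> (\<Sum>i. emeasure lebesgue (D i))"
      by (rule emeasure_subadditive_countably) auto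
    also have "\<dots> \<le> (\<Sum>i. ennreal (V * \<delta>) * ennreal (diameter (C i)))"
      by (intro suminf_le eD) auto
    also have "\<dots> \<le> ennreal (V * \<delta>) * ennreal (h + 1)"
      using C(4) by (simp add: ennreal_suminf_cmult mult_left_mono)
    also have "\<dots> = ennreal (V * \<delta> * (h + 1))" using V h \<delta> by (intro ennreal_mult[symmetric]) auto
    also have "V * \<delta> * (h + 1) = e" using V h by (simp add: \<delta>_def)
    finally have le: "emeasure lebesgue (\<Union>i. D i) \<le> ennreal e" .
    show "\<exists>T. A \<subseteq> T \<and> T \<in> lmeasurable \<and> measure lebesgue T \<le> e"
    proof (intro exI conjI)
      show "A \<subseteq> (\<Union>i. D i)" using C(1) CD by blast
      show "(\<Union>i. D i) \<in> lmeasurable" using le by (auto simp: fmeasurable_def intro: le_less_trans)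
      show "measure lebesgue (\<Union>i. D i) \<le> e"
        using le e by (auto simp: measure_def intro: enn2real_leI)
    qed
  qed
  then show ?thesis by (simp add: negligible_iff_null_sets)
qed

section \<open>Testing densities on curves with smooth functions\<close>

text \<open>Since \<open>exp (- n exp (n s))\<close> tends to \<open>1\<close> for \<open>s < 0\<close> and to \<open>0\<close> for \<open>s \<ge> 0\<close>, this product of smooth steps
  tends to the indicator of the open box, also on its boundary.\<close>

definition box_bump :: "nat \<Rightarrow> 'a::euclidean_space \<Rightarrow> 'a \<Rightarrow> 'a \<Rightarrow> real" where
  "box_bump n a b x =
     exp (- (real n * (\<Sum>i\<in>Basis. exp (real n * (a \<bullet> i - x \<bullet> i)) + exp (real n * (x \<bullet> i - b \<bullet> i)))))"

lemma box_bump_bounds: "0 \<le> box_bump n a b x" "box_bump n a b x \<le> 1"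
  by (auto simp: box_bump_def intro!: mult_nonneg_nonneg sum_nonneg add_nonneg_nonneg)

lemma box_bump_tendsto:
  fixes a b x :: "'a::euclidean_space"
  shows "(\<lambda>n. box_bump n a b x) \<longlonglongrightarrow> indicator (box a b) x"
proof -
  define E where "E n i = exp (real n * (a \<bullet> i - x \<bullet> i)) + exp (real n * (x \<bullet> i - b \<bullet> i))" for n i
  have E0: "0 \<le> E n i" for n i by (simp add: E_def)
  have bump: "box_bump n a b x = exp (- (real n * (\<Sum>i\<in>Basis. E n i)))" for n
    by (simp add: box_bump_def E_def)
  show ?thesis
  proof (cases "x \<in> box a b")
    case True
    have "(\<lambda>n. real n * E n i) \<longlonglongrightarrow> 0" if "i \<in> Basis" for i
    proof -
      have c: "a \<bullet> i - x \<bullet> i < 0" "x \<bullet> i - b \<bullet> i < 0" using True that by (auto simp: mem_box)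
      have lim: "(\<lambda>n. real n * exp (real n * c)) \<longlonglongrightarrow> 0" if "c < 0" for c :: real
        using powser_times_n_limit_0[of "exp c"] that by (simp add: exp_of_nat_mult)
      from tendsto_add[OF lim[OF c(1)] lim[OF c(2)]] show ?thesis
        by (simp add: E_def algebra_simps)
    qed
    then have "(\<lambda>n. \<Sum>i\<in>Basis. real n * E n i) \<longlonglongrightarrow> (\<Sum>i\<in>(Basis::'a set). 0)"
      by (intro tendsto_sum) auto
    then have "(\<lambda>n. exp (- (\<Sum>i\<in>Basis. real n * E n i))) \<longlonglongrightarrow> exp (- 0)"
      by (intro tendsto_exp tendsto_minus) simp
    then show ?thesis using True by (simp add: bump sum_distrib_left)
  next
    case False
    then obtain i where i: "i \<in> Basis" "x \<bullet> i \<le> a \<bullet> i \<or> b \<bullet> i \<le> x \<bullet> i" by (auto simp: mem_box not_less)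
    have E1: "1 \<le> E n i" for n
    proof -
      have "1 \<le> exp (real n * (a \<bullet> i - x \<bullet> i)) \<or> 1 \<le> exp (real n * (x \<bullet> i - b \<bullet> i))"
        using i(2) by auto
      then show ?thesis
        using exp_ge_zero[of "real n * (a \<bullet> i - x \<bullet> i)"] exp_ge_zero[of "real n * (x \<bullet> i - b \<bullet> i)"]
        unfolding E_def by linarith
    qed
    have le: "box_bump n a b x \<le> exp (- real n)" for n
    proof -
      have "E n i \<le> (\<Sum>i\<in>Basis. E n i)"
        by (rule member_le_sum) (use i(1) E0 in auto)
      then have "real n * 1 \<le> real n * (\<Sum>i\<in>Basis. E n i)"
        using E1[of n] by (intro mult_left_mono) linarith+
      then show ?thesis unfolding bump by simp
    qed
    have lim: "(\<lambda>n. exp (- real n)) \<longlonglongrightarrow> 0"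
      using LIMSEQ_realpow_zero[of "exp (- 1)"] exp_of_nat_mult[of _ "- 1 :: real"] by simp
    have "(\<lambda>n. box_bump n a b x) \<longlonglongrightarrow> 0"
      by (rule tendsto_sandwich[OF _ _ tendsto_const lim])
         (intro always_eventually allI box_bump_bounds le)+
    then show ?thesis using False by simp
  qed
qed

lemma C1_on_UNIV_I:
  assumes D: "\<And>x. (w has_derivative D x) (at x)"
    and cont: "\<And>v. continuous_on UNIV (\<lambda>x. D x v)"
  shows "C1_on UNIV w"
  using frechet_derivative_at[OF D] cont D
  by (auto simp: C1_on_def pderiv2_def differentiable_def simp flip: fun_eq_iff)

lemma C1_on_box_bump: "C1_on UNIV (box_bump n a b)"
proof (rule C1_on_UNIV_I)
  let ?D = "\<lambda>x v. box_bump n a b x * (- (real n * (\<Sum>i\<in>Basis.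
      exp (real n * (a \<bullet> i - x \<bullet> i)) * (real n * - (v \<bullet> i)) + exp (real n * (x \<bullet> i - b \<bullet> i)) * (real n * (v \<bullet> i)))))"
  show "(box_bump n a b has_derivative ?D x) (at x)" for x
    unfolding box_bump_def by (auto intro!: derivative_eq_intros simp: mult_ac)
  show "continuous_on UNIV (\<lambda>x. ?D x v)" for v
    unfolding box_bump_def by (intro continuous_intros)
qed

lemma C1_on_const: "C1_on UNIV (\<lambda>_. c)"
  by (rule C1_on_UNIV_I[where D = "\<lambda>_ _. 0"]) auto

lemma C1_on_continuous_on: "C1_on S w \<Longrightarrow> continuous_on S w"
  unfolding C1_on_def
  by (intro continuous_at_imp_continuous_on ballI) (auto intro: differentiable_imp_continuous_within)

lemma borel_measurable_hausdorff1: "f \<in> borel_measurable borel \<Longrightarrow> f \<in> borel_measurable hausdorff1"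
  using borel_sets_hausdorff1 by (auto simp: measurable_def)

text \<open>The fundamental lemma of the calculus of variations for arc length. The functions
  \<^const>\<open>box_bump\<close> and dominated convergence give vanishing integrals over open boxes; these generate the
  Borel sets, and every measurable set of finite arc length differs from a Borel set by a null set.\<close>

lemma integrable_zero_if_C1_test:
  fixes f :: "plane \<Rightarrow> 'b::{banach, second_countable_topology}"
  assumes S: "S \<in> sets hausdorff1" "emeasure hausdorff1 S < \<infinity>"
    and f: "integrable hausdorff1 f" and supp: "\<And>x. x \<notin> S \<Longrightarrow> f x = 0"
    and test: "\<And>\<phi> :: plane \<Rightarrow> real. C1_on UNIV \<phi> \<Longrightarrow> (LINT x|hausdorff1. \<phi> x *\<^sub>R f x) = 0"
  shows "AE x in hausdorff1. f x = 0"
proof -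
  let ?H = "hausdorff1 :: plane measure"
  have borelH: "B \<in> sets ?H" if "B \<in> sets borel" for B
    using that borel_sets_hausdorff1 by blast
  have fset: "set_integrable ?H A f" if "A \<in> sets ?H" for A
    using integrable_mult_indicator[OF that f] by (simp add: set_integrable_def)
  have total: "(LINT x|?H. f x) = 0"
    using test[OF C1_on_const[of 1]] by simp
  have borel0: "(LINT x:B|?H. f x) = 0" if "B \<in> sets borel" for B
  proof -
    have "Int_stable (range (\<lambda>(a, b). box a b :: plane set))"
      by (auto simp: Int_stable_def box_Int_box)
    moreover have "range (\<lambda>(a, b). box a b :: plane set) \<subseteq> Pow UNIV" by simp
    moreover have "B \<in> sigma_sets UNIV (range (\<lambda>(a, b). box a b :: plane set))"
      using that by (simp add: borel_eq_box)
    ultimately show ?thesis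
    proof (induct rule: sigma_sets_induct_disjoint)
      fix A assume "A \<in> range (\<lambda>(a, b). box a b :: plane set)"
      then obtain a b where A: "A = box a b" by auto
      have "(\<lambda>n. LINT x|?H. box_bump n a b x *\<^sub>R f x) \<longlonglongrightarrow> (LINT x|?H. indicator (box a b) x *\<^sub>R f x)"
      proof (rule integral_dominated_convergence[where w = "\<lambda>x. norm (f x)"])
        show "(\<lambda>x. indicator (box a b) x *\<^sub>R f x) \<in> borel_measurable ?H"
          using fset[OF borelH[of "box a b"]] by (simp add: set_integrable_def borel_measurable_integrable)
        show "(\<lambda>x. box_bump n a b x *\<^sub>R f x) \<in> borel_measurable ?H" for n
          using f by (intro borel_measurable_scaleR borel_measurable_integrable borel_measurable_hausdorff1
              borel_measurable_continuous_onI C1_on_continuous_on C1_on_box_bump)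
        show "integrable ?H (\<lambda>x. norm (f x))" using f by simp
        show "AE x in ?H. (\<lambda>n. box_bump n a b x *\<^sub>R f x) \<longlonglongrightarrow> indicator (box a b) x *\<^sub>R f x"
          by (intro AE_I2 tendsto_scaleR box_bump_tendsto tendsto_const)
        show "AE x in ?H. norm (box_bump n a b x *\<^sub>R f x) \<le> norm (f x)" for n
          using box_bump_bounds[of n a b] by (intro AE_I2) (simp add: mult_left_le_one_le)
      qed
      moreover have "(LINT x|?H. box_bump n a b x *\<^sub>R f x) = 0" for n
        by (rule test[OF C1_on_box_bump])
      ultimately show "(LINT x:A|?H. f x) = 0"
        using LIMSEQ_unique[OF _ tendsto_const] by (auto simp: A set_lebesgue_integral_def)
    next
      fix A assume A: "A \<in> sigma_sets UNIV (range (\<lambda>(a, b). box a b :: plane set))" and 0: "(LINT x:A|?H. f x) = 0"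
      then have "A \<in> sets ?H" by (intro borelH) (simp add: borel_eq_box)
      have "(LINT x:UNIV - A|?H. f x) = (LINT x|?H. f x - indicator A x *\<^sub>R f x)"
        unfolding set_lebesgue_integral_def by (intro Bochner_Integration.integral_cong) (auto simp: indicator_def)
      also have "\<dots> = (LINT x|?H. f x) - (LINT x:A|?H. f x)"
        using f fset[OF \<open>A \<in> sets ?H\<close>] unfolding set_lebesgue_integral_def set_integrable_def
        by (rule Bochner_Integration.integral_diff)
      finally show "(LINT x:UNIV - A|?H. f x) = 0" using total 0 by simp
    next
      fix A :: "nat \<Rightarrow> plane set"
      assume A: "disjoint_family A" "range A \<subseteq> sigma_sets UNIV (range (\<lambda>(a, b). box a b :: plane set))"
        and 0: "\<And>i. (LINT x:A i|?H. f x) = 0"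
      then have "A i \<in> sets ?H" for i by (intro borelH) (auto simp: borel_eq_box)
      then have "(LINT x:(\<Union>i. A i)|?H. f x) = (\<Sum>i. (LINT x:A i|?H. f x))"
        using A(1) by (intro lebesgue_integral_countable_add fset) (auto simp: disjoint_family_on_def)
      then show "(LINT x:(\<Union>i. A i)|?H. f x) = 0" using 0 by simp
    qed (simp add: set_lebesgue_integral_def)
  qed
  interpret S: finite_measure "restrict_space ?H S"
    using S by (intro finite_measureI) (auto simp: emeasure_restrict_space space_restrict_space)
  have "AE x in restrict_space ?H S. f x = 0"
  proof (rule S.density_zero)
    show "integrable (restrict_space ?H S) f"
      using S(1) fset[OF S(1)] by (subst integrable_restrict_space) (auto simp: set_integrable_def)
    fix A assume "A \<in> sets (restrict_space ?H S)"
    then have A: "A \<in> sets ?H" "A \<subseteq> S"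
      using S(1) by (auto simp: sets_restrict_space_iff)
    have "hausdorff1_outer A < \<infinity>"
      using emeasure_mono[OF A(2) S(1)] S(2) emeasure_hausdorff1[OF A(1)] by auto
    then obtain B where B: "B \<in> sets borel" "A \<subseteq> B" "hausdorff1_outer B = hausdorff1_outer A"
      by (rule hausdorff1_borel_hull)
    have "emeasure ?H (B - A) = 0"
      using B A borelH[OF B(1)] \<open>hausdorff1_outer A < \<infinity>\<close>
      by (subst emeasure_Diff) (auto simp: emeasure_hausdorff1)
    then have ae: "AE x in ?H. x \<notin> B - A"
      using borelH[OF B(1)] A by (intro AE_not_in) (auto simp: null_sets_def)
    have "(LINT x:A|restrict_space ?H S. f x) = (LINT x:A|?H. f x)"
      using A S(1) unfolding set_lebesgue_integral_def
      by (subst integral_restrict_space) (auto intro!: Bochner_Integration.integral_cong simp: indicator_def)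
    also have "\<dots> = (LINT x:B|?H. f x)"
      unfolding set_lebesgue_integral_def
    proof (rule integral_cong_AE)
      show "AE x in ?H. indicat_real A x *\<^sub>R f x = indicat_real B x *\<^sub>R f x"
        using ae by eventually_elim (use B(2) in \<open>auto simp: indicator_def\<close>)
    qed (use fset[OF A(1)] fset[OF borelH[OF B(1)]] in \<open>auto simp: set_integrable_def\<close>)
    also have "\<dots> = 0" by (rule borel0[OF B(1)])
    finally show "(LINT x:A|restrict_space ?H S. f x) = 0" .
  qed
  then show ?thesis
    using S(1) supp by (auto simp: AE_restrict_space_iff elim!: eventually_mono)
qed

section \<open>Outward normals\<close>

text \<open>For a fixed direction \<open>h\<close> that is not tangential, the tolerance \<open>\<epsilon>\<close> in the definition of the normal can be
  chosen so small that the ray from \<open>x\<close> along \<open>h\<close> lies in the cone on which membership is decided.\<close>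

lemma is_outward_normal_radial:
  assumes n: "is_outward_normal K x \<nu>"
  shows "h \<bullet> \<nu> < 0 \<Longrightarrow> eventually (\<lambda>t. x + t *\<^sub>R h \<in> K) (at_right 0)"
    and "h \<bullet> \<nu> > 0 \<Longrightarrow> eventually (\<lambda>t. x + t *\<^sub>R h \<notin> K) (at_right 0)"
proof -
  have main: "eventually (\<lambda>t. (h \<bullet> \<nu> < 0 \<longrightarrow> x + t *\<^sub>R h \<in> K) \<and> (h \<bullet> \<nu> > 0 \<longrightarrow> x + t *\<^sub>R h \<notin> K)) (at_right 0)"
    if 0: "h \<bullet> \<nu> \<noteq> 0"
  proof -
    have h: "norm h > 0" using 0 by auto
    define \<epsilon> where "\<epsilon> = \<bar>h \<bullet> \<nu>\<bar> / (2 * norm h)"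
    have \<epsilon>: "\<epsilon> > 0" "\<epsilon> * norm h < \<bar>h \<bullet> \<nu>\<bar>" using 0 h by (auto simp: \<epsilon>_def)
    then obtain \<delta> where \<delta>: "\<delta> > 0" and "\<forall>y\<in>ball x \<delta>.
        ((y - x) \<bullet> \<nu> < - \<epsilon> * norm (y - x) \<longrightarrow> y \<in> K) \<and> ((y - x) \<bullet> \<nu> > \<epsilon> * norm (y - x) \<longrightarrow> y \<notin> K)"
      using n unfolding is_outward_normal_def by blast
    note * = bspec[OF this(2)]
    show ?thesis
    proof (rule eventually_at_rightI[of 0 "\<delta> / norm h"])
      fix t assume t: "t \<in> {0<..<\<delta> / norm h}"
      then have "x + t *\<^sub>R h \<in> ball x \<delta>" using h by (simp add: dist_norm field_simps)
      moreover have "t * (\<epsilon> * norm h) < t * \<bar>h \<bullet> \<nu>\<bar>" using \<epsilon>(2) t by simp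
      then have "h \<bullet> \<nu> < 0 \<Longrightarrow> (t *\<^sub>R h) \<bullet> \<nu> < - \<epsilon> * norm (t *\<^sub>R h)"
        "h \<bullet> \<nu> > 0 \<Longrightarrow> (t *\<^sub>R h) \<bullet> \<nu> > \<epsilon> * norm (t *\<^sub>R h)"
        using t by (auto simp: abs_if mult.left_commute)
      ultimately show "(h \<bullet> \<nu> < 0 \<longrightarrow> x + t *\<^sub>R h \<in> K) \<and> (h \<bullet> \<nu> > 0 \<longrightarrow> x + t *\<^sub>R h \<notin> K)"
        using *[of "x + t *\<^sub>R h"] by simp
    qed (use \<delta> h in auto)
  qed
  show "h \<bullet> \<nu> < 0 \<Longrightarrow> eventually (\<lambda>t. x + t *\<^sub>R h \<in> K) (at_right 0)"
    using main by (auto elim: eventually_mono)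
  show "h \<bullet> \<nu> > 0 \<Longrightarrow> eventually (\<lambda>t. x + t *\<^sub>R h \<notin> K) (at_right 0)"
    using main by (auto elim: eventually_mono)
qed

lemma is_outward_normal_norm: "is_outward_normal K x \<nu> \<Longrightarrow> norm \<nu> = 1"
  by (simp add: is_outward_normal_def)

lemma unit_diff_inner:
  fixes \<nu> \<nu>' :: "'a::real_inner"
  assumes "norm \<nu> = 1" "norm \<nu>' = 1"
  shows "(\<nu>' - \<nu>) \<bullet> \<nu> = - (norm (\<nu>' - \<nu>))\<^sup>2 / 2" "(\<nu>' - \<nu>) \<bullet> \<nu>' = (norm (\<nu>' - \<nu>))\<^sup>2 / 2"
proof -
  have "\<nu> \<bullet> \<nu> = 1" "\<nu>' \<bullet> \<nu>' = 1" using assms by (auto simp: norm_eq_1)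
  then show "(\<nu>' - \<nu>) \<bullet> \<nu> = - (norm (\<nu>' - \<nu>))\<^sup>2 / 2" "(\<nu>' - \<nu>) \<bullet> \<nu>' = (norm (\<nu>' - \<nu>))\<^sup>2 / 2"
    by (auto simp: power2_norm_eq_inner inner_diff_left inner_diff_right inner_commute)
qed

text \<open>Otherwise the ray in direction \<open>- (\<nu> + \<nu>')\<close> would enter both of the disjoint sets.\<close>

lemma is_outward_normal_opposite:
  assumes "is_outward_normal K x \<nu>" "is_outward_normal K' x \<nu>'" "K \<inter> K' = {}"
  shows "\<nu>' = - \<nu>"
proof (rule ccontr)
  assume "\<nu>' \<noteq> - \<nu>"
  then have pos: "norm (- \<nu> - \<nu>') > 0" by (metis right_minus_eq zero_less_norm_iff)
  have sq: "(norm (- \<nu> - \<nu>'))\<^sup>2 > 0" using pos by simp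
  have "(- \<nu> - \<nu>') \<bullet> \<nu>' < 0" "(- \<nu> - \<nu>') \<bullet> \<nu> < 0"
    using unit_diff_inner[of \<nu>' "- \<nu>"] is_outward_normal_norm[OF assms(1)]
      is_outward_normal_norm[OF assms(2)] sq
    unfolding inner_minus_right norm_minus_cancel by linarith+
  from is_outward_normal_radial(1)[OF assms(2) this(1)] is_outward_normal_radial(1)[OF assms(1) this(2)]
  have "eventually (\<lambda>t. x + t *\<^sub>R (- \<nu> - \<nu>') \<in> K \<inter> K') (at_right (0::real))"
    by eventually_elim simp
  then show False using assms(3) by simp
qed

lemma is_outward_normal_unique:
  assumes "is_outward_normal K x \<nu>" "is_outward_normal K x \<nu>'"
  shows "\<nu>' = \<nu>"
proof (rule ccontr)
  assume "\<nu>' \<noteq> \<nu>"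
  then have "(norm (\<nu>' - \<nu>))\<^sup>2 > 0" by simp
  then have "(\<nu>' - \<nu>) \<bullet> \<nu> < 0" "(\<nu>' - \<nu>) \<bullet> \<nu>' > 0"
    using unit_diff_inner[of \<nu> \<nu>'] assms[THEN is_outward_normal_norm] by linarith+
  from is_outward_normal_radial(1)[OF assms(1) this(1)] is_outward_normal_radial(2)[OF assms(2) this(2)]
  have "eventually (\<lambda>t. False) (at_right (0::real))"
    by eventually_elim simp
  then show False by simp
qed

lemma outward_normal_eq: "is_outward_normal K x \<nu> \<Longrightarrow> outward_normal K x = \<nu>"
  unfolding outward_normal_def using is_outward_normal_unique by blast

text \<open>The points at which \<open>\<nu>\<close> passes the test for an outward normal at scale \<open>\<delta>\<close> with tolerance \<open>\<epsilon>\<close>. For a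
  fixed direction this is a Borel set, and it approximates the implicitly defined normal.\<close>

definition near_normal_set :: "plane set \<Rightarrow> real \<Rightarrow> real \<Rightarrow> plane \<Rightarrow> plane set" where
  "near_normal_set K \<epsilon> \<delta> \<nu> = {x. \<forall>h. norm h < \<delta> \<longrightarrow>
     (h \<bullet> \<nu> < - \<epsilon> * norm h \<longrightarrow> x + h \<in> K) \<and> (h \<bullet> \<nu> > \<epsilon> * norm h \<longrightarrow> x + h \<notin> K)}"

text \<open>Points outside: the condition is an intersection of closed translates. Points inside: the open
  cone of directions is a countable union of compact sets \<open>C\<close>, and those \<open>x\<close> for which \<open>x + C\<close> meets the
  closed complement of \<open>K\<close> form a closed set.\<close>

lemma near_normal_set_borel:
  assumes "open K"
  shows "near_normal_set K \<epsilon> \<delta> \<nu> \<in> sets borel"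
proof -
  define U where "U = {h. norm h < \<delta> \<and> h \<bullet> \<nu> < - \<epsilon> * norm h}"
  define V where "V = {h. norm h < \<delta> \<and> h \<bullet> \<nu> > \<epsilon> * norm h}"
  have "open U" unfolding U_def
    by (intro open_Collect_conj open_Collect_less continuous_intros)
  then obtain C where C: "\<And>n::nat. compact (C n)" "\<Union>(range C) = U"
    by (rule open_Union_compact_subsets) blast
  have cl: "closed {x. \<exists>h\<in>C n. x + h \<in> - K}" for n
  proof -
    have "{x. \<exists>h\<in>C n. x + h \<in> - K} = (\<Union>x\<in>- K. \<Union>y\<in>C n. {x - y})"
      by (auto simp: algebra_simps) (metis Compl_iff add_diff_cancel_right')
    then show ?thesis using closed_compact_differences[of "- K" "C n"] C(1) assms by (simp add: closed_Compl)
  qed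
  have "near_normal_set K \<epsilon> \<delta> \<nu> = (\<Inter>n. - {x. \<exists>h\<in>C n. x + h \<in> - K}) \<inter> (\<Inter>h\<in>V. (\<lambda>x. x + h) -` (- K))"
  proof -
    have "(\<Inter>n. - {x. \<exists>h\<in>C n. x + h \<in> - K}) = {x. \<forall>h\<in>U. x + h \<in> K}"
      using C(2) by blast
    then show ?thesis by (auto simp: near_normal_set_def U_def V_def)
  qed
  moreover have "(\<Inter>n. - {x. \<exists>h\<in>C n. x + h \<in> - K}) \<in> sets borel"
    using cl by (intro sets.countable_INT'') (auto intro!: borel_open simp: open_Compl)
  moreover have "closed (\<Inter>h\<in>V. (\<lambda>x. x + h) -` (- K))"
    using assms by (intro closed_INT ballI continuous_closed_vimage continuous_intros) (auto simp: closed_Compl)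
  ultimately show ?thesis by (simp add: borel_closed)
qed

text \<open>A direction \<open>\<nu>'\<close> further than \<open>2 \<epsilon>\<close> from \<open>\<nu>\<close> is ruled out by the ray along \<open>\<nu>' - \<nu>\<close>: it enters \<open>K\<close> by
  the choice of \<open>\<nu>\<close>, while the test for \<open>\<nu>'\<close> puts it outside.\<close>

lemma near_normal_set_close:
  assumes n: "is_outward_normal K x \<nu>" and x: "x \<in> near_normal_set K \<epsilon> \<delta> \<nu>'"
    and \<nu>': "norm \<nu>' = 1" and "\<epsilon> > 0" "\<delta> > 0"
  shows "norm (\<nu>' - \<nu>) \<le> 2 * \<epsilon>"
proof (rule ccontr)
  define h where "h = \<nu>' - \<nu>"
  assume "\<not> norm (\<nu>' - \<nu>) \<le> 2 * \<epsilon>"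
  then have h: "norm h > 2 * \<epsilon>" by (simp add: h_def)
  then have h0: "norm h > 0" using \<open>\<epsilon> > 0\<close> by linarith
  note inner = unit_diff_inner[OF is_outward_normal_norm[OF n] \<nu>', folded h_def]
  have "h \<bullet> \<nu> < 0" using inner(1) h0 by simp
  then have "eventually (\<lambda>t. x + t *\<^sub>R h \<in> K) (at_right 0)"
    by (rule is_outward_normal_radial(1)[OF n])
  moreover have "eventually (\<lambda>t. t \<in> {0<..<\<delta> / norm h}) (at_right 0)"
    using h0 \<open>\<delta> > 0\<close> by (intro eventually_at_right_real) auto
  then have "eventually (\<lambda>t. x + t *\<^sub>R h \<notin> K) (at_right 0)"
  proof eventually_elim
    case (elim t)
    then have "norm (t *\<^sub>R h) < \<delta>" using h0 by (simp add: field_simps)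
    moreover have "h \<bullet> \<nu>' > \<epsilon> * norm h"
    proof -
      have "2 * (\<epsilon> * norm h) < norm h * norm h"
        using mult_strict_right_mono[OF h h0] by (simp only: mult.assoc)
      then show ?thesis using inner(2) by (simp add: power2_eq_square)
    qed
    then have "t * (\<epsilon> * norm h) < t * (h \<bullet> \<nu>')" using elim by simp
    ultimately show ?case using x elim unfolding near_normal_set_def
      by (auto simp: mult_ac)
  qed
  ultimately have "eventually (\<lambda>t. False) (at_right (0::real))" by eventually_elim simp
  then show False by simp
qed

lemma is_outward_normal_near_normal_set:
  assumes n: "is_outward_normal K x \<nu>" and "norm (\<nu>' - \<nu>) < \<epsilon>" "\<epsilon> > 0"
  obtains m :: nat where "x \<in> near_normal_set K (2 * \<epsilon>) (1 / real (Suc m)) \<nu>'"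
proof -
  obtain \<delta> where \<delta>: "\<delta> > 0" and "\<forall>y\<in>ball x \<delta>.
        ((y - x) \<bullet> \<nu> < - \<epsilon> * norm (y - x) \<longrightarrow> y \<in> K) \<and> ((y - x) \<bullet> \<nu> > \<epsilon> * norm (y - x) \<longrightarrow> y \<notin> K)"
    using n \<open>\<epsilon> > 0\<close> unfolding is_outward_normal_def by blast
  note * = bspec[OF this(2)]
  obtain m where m: "1 / real (Suc m) < \<delta>"
    using reals_Archimedean[OF \<delta>] by (auto simp: inverse_eq_divide)
  have "x \<in> near_normal_set K (2 * \<epsilon>) (1 / real (Suc m)) \<nu>'"
    unfolding near_normal_set_def
  proof (intro CollectI allI impI)
    fix h :: plane assume h: "norm h < 1 / real (Suc m)"
    have "\<bar>h \<bullet> (\<nu>' - \<nu>)\<bar> \<le> norm h * norm (\<nu>' - \<nu>)" by (rule Cauchy_Schwarz_ineq2)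
    also have "\<dots> \<le> norm h * \<epsilon>" using assms by (intro mult_left_mono) auto
    finally have "\<bar>h \<bullet> \<nu>' - h \<bullet> \<nu>\<bar> \<le> \<epsilon> * norm h" by (simp add: inner_diff_right mult.commute)
    then show "(h \<bullet> \<nu>' < - (2 * \<epsilon>) * norm h \<longrightarrow> x + h \<in> K) \<and> (h \<bullet> \<nu>' > 2 * \<epsilon> * norm h \<longrightarrow> x + h \<notin> K)"
      using *[of "x + h"] h m by (auto simp: dist_norm)
  qed
  then show ?thesis by (rule that)
qed

text \<open>The normal is the limit of \<open>d k\<close>, where \<open>k\<close> is the first index in a dense sequence of unit vectors that
  passes the test with tolerance \<open>2 / (n + 1)\<close> at some scale. Measurability is needed because integrals of
  non-measurable functions are zero by convention, so that without it the defining identity of a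
  trace would not be additive.\<close>

lemma outward_normal_measurable:
  assumes "open K"
  obtains f where "f \<in> borel_measurable borel"
    "\<And>x \<nu>. is_outward_normal K x \<nu> \<Longrightarrow> f x = \<nu>"
proof -
  obtain T where T: "countable T" "T \<subseteq> sphere (0::plane) 1" "sphere 0 1 \<subseteq> closure T"
    using separable[of "sphere (0::plane) 1"] by blast
  have "sphere (0::plane) 1 \<noteq> {}" by (simp add: sphere_eq_empty)
  then have "T \<noteq> {}" using T(3) by auto
  define d where "d = from_nat_into T"
  have d: "norm (d k) = 1" for k using from_nat_into[OF \<open>T \<noteq> {}\<close>, of k] T(2) by (auto simp: d_def)
  define \<epsilon> where "\<epsilon> n = 1 / real (Suc n)" for n
  have \<epsilon>: "\<epsilon> n > 0" for n by (simp add: \<epsilon>_def)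
  define P where "P n x k \<longleftrightarrow> (\<exists>m. x \<in> near_normal_set K (2 * \<epsilon> n) (1 / real (Suc m)) (d k))" for n x k
  define f where "f n x = d (LEAST k. P n x k)" for n x
  have [measurable]: "near_normal_set K e r \<nu> \<in> sets borel" for e r \<nu>
    by (rule near_normal_set_borel[OF assms])
  have [measurable]: "f n \<in> borel_measurable borel" for n
  proof -
    have "(\<lambda>x. LEAST k. P n x k) \<in> measurable borel (count_space UNIV)"
      unfolding P_def by measurable
    then show ?thesis unfolding f_def by (rule measurable_compose) simp
  qed
  show ?thesis
  proof (rule that)
    show "(\<lambda>x. lim (\<lambda>n. f n x)) \<in> borel_measurable borel"
      by (rule borel_measurable_lim_metric) measurable
    fix x \<nu> assume n: "is_outward_normal K x \<nu>"
    have le: "dist (f n x) \<nu> \<le> 4 * \<epsilon> n" for n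
    proof -
      have "\<nu> \<in> closure T" using T(3) is_outward_normal_norm[OF n] by auto
      then obtain \<nu>' where "\<nu>' \<in> T" "dist \<nu>' \<nu> < \<epsilon> n" using \<epsilon>[of n] by (auto simp: closure_approachable)
      then obtain k where "norm (d k - \<nu>) < \<epsilon> n"
        using from_nat_into_surj[OF T(1)] by (metis d_def dist_norm)
      then have "P n x k"
        using is_outward_normal_near_normal_set[OF n _ \<epsilon>] unfolding P_def by metis
      then have "P n x (LEAST k. P n x k)" by (rule LeastI)
      then show ?thesis
        using near_normal_set_close[OF n _ d, of "2 * \<epsilon> n"] \<epsilon>[of n]
        by (auto simp: P_def f_def dist_norm)
    qed
    have "(\<lambda>n. 4 * \<epsilon> n) \<longlonglongrightarrow> 4 * 0"
      unfolding \<epsilon>_def by (intro tendsto_mult tendsto_const LIMSEQ_Suc[OF lim_1_over_n])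
    then have lim: "(\<lambda>n. 4 * \<epsilon> n) \<longlonglongrightarrow> 0" by simp
    have "(\<lambda>n. dist (f n x) \<nu>) \<longlonglongrightarrow> 0"
      by (rule tendsto_sandwich[OF _ _ tendsto_const lim]) (intro always_eventually allI le zero_le_dist)+
    then have "(\<lambda>n. f n x) \<longlonglongrightarrow> \<nu>" by (simp add: tendsto_dist_iff[symmetric])
    then show "lim (\<lambda>n. f n x) = \<nu>" by (rule limI)
  qed
qed

section \<open>Traces of Helmholtz fields\<close>

text \<open>The properties of mesh elements that the trace calculus uses; they carry over to the domain
  that the elements make up.\<close>

definition regular_open :: "plane set \<Rightarrow> bool" where
  "regular_open K \<longleftrightarrow> open K \<and> bounded K \<and> emeasure hausdorff1 (frontier K) < \<infinity> \<and>
     (AE x in hausdorff1. x \<in> frontier K \<longrightarrow> (\<exists>\<nu>. is_outward_normal K x \<nu>))"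

lemma frontier_sets_hausdorff1 [simp]: "frontier K \<in> sets hausdorff1"
  by (simp add: closed_in_sets_hausdorff1)

lemma set_integrable_bdd_scale:
  fixes f :: "'a \<Rightarrow> 'b::{banach, second_countable_topology}" and c :: "'a \<Rightarrow> real"
  assumes "set_integrable M A f" and c: "set_borel_measurable M A c"
    and "AE x in M. x \<in> A \<longrightarrow> \<bar>c x\<bar> \<le> C"
  shows "set_integrable M A (\<lambda>x. c x *\<^sub>R f x)"
  unfolding set_integrable_def
proof (rule Bochner_Integration.integrable_bound)
  let ?F = "\<lambda>x. indicator A x *\<^sub>R f x"
  show "integrable M (\<lambda>x. \<bar>C\<bar> *\<^sub>R ?F x)" using assms(1) unfolding set_integrable_def by (intro integrable_scaleR_right)
  have "(\<lambda>x. (indicator A x *\<^sub>R c x) *\<^sub>R ?F x) \<in> borel_measurable M"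
    using c borel_measurable_integrable[OF assms(1)[unfolded set_integrable_def]]
    unfolding set_borel_measurable_def by (rule borel_measurable_scaleR)
  then show "(\<lambda>x. indicator A x *\<^sub>R c x *\<^sub>R f x) \<in> borel_measurable M"
    by (rule measurable_cong[THEN iffD1, rotated]) (auto simp: indicator_def)
  show "AE x in M. norm (indicator A x *\<^sub>R c x *\<^sub>R f x) \<le> norm (\<bar>C\<bar> *\<^sub>R ?F x)"
    using assms(3) by eventually_elim (auto simp: indicator_def intro!: mult_right_mono)
qed

lemma set_borel_measurable_borel:
  fixes c :: "'a::metric_space \<Rightarrow> real"
  assumes "sets borel \<subseteq> sets M" "space M = UNIV" "A \<in> sets M" "c \<in> borel_measurable borel"
  shows "set_borel_measurable M A c"
proof -
  have "c \<in> borel_measurable M" using assms by (auto simp: measurable_def)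
  then show ?thesis using assms(3) by (simp add: set_borel_measurable_def)
qed

lemma set_integrable_continuous_scale:
  fixes f :: "plane \<Rightarrow> 'b::{banach, second_countable_topology}" and c :: "plane \<Rightarrow> real"
  assumes M: "sets borel \<subseteq> sets M" "space M = UNIV" and A: "A \<in> sets M" "bounded A"
    and f: "set_integrable M A f" and c: "continuous_on UNIV c"
  shows "set_integrable M A (\<lambda>x. c x *\<^sub>R f x)"
proof -
  have "compact (c ` closure A)"
    using A(2) c by (intro compact_continuous_image) (auto intro: continuous_on_subset)
  then obtain C where "\<forall>x\<in>c ` closure A. norm x \<le> C"
    by (meson compact_imp_bounded bounded_iff)
  then have "\<And>x. x \<in> A \<Longrightarrow> \<bar>c x\<bar> \<le> C" using closure_subset by fastforce
  then show ?thesis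
    using M A(1) c f
    by (intro set_integrable_bdd_scale[where C = C] set_borel_measurable_borel borel_measurable_continuous_onI) auto
qed

lemma set_integrable_if_square_integrable:
  assumes f: "square_integrable_on M A f" and A: "A \<in> sets M" "emeasure M A < \<infinity>"
  shows "set_integrable M A f"
  unfolding set_integrable_def
proof (rule Bochner_Integration.integrable_bound)
  show "integrable M (\<lambda>x. indicator A x *\<^sub>R (1 + (norm (f x))\<^sup>2))"
    unfolding scaleR_right_distrib using f A
    by (intro Bochner_Integration.integrable_add)
       (auto simp: square_integrable_on_def set_integrable_def)
  show "(\<lambda>x. indicat_real A x *\<^sub>R f x) \<in> borel_measurable M"
    using f by (simp add: square_integrable_on_def set_borel_measurable_def)
  have "norm z \<le> 1 + (norm z)\<^sup>2" for z :: 'b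
    using sum_power2_ge_zero[of "norm z - 1/2" 0] by (simp add: power2_eq_square algebra_simps)
  then show "AE x in M. norm (indicat_real A x *\<^sub>R f x) \<le> norm (indicat_real A x *\<^sub>R (1 + (norm (f x))\<^sup>2))"
    by (intro AE_I2) (auto simp: indicator_def intro: order_trans[OF _ abs_ge_self])
qed

lemma norm_diff_power2_le: "(norm (a - b))\<^sup>2 \<le> 2 * (norm a)\<^sup>2 + 2 * (norm (b::'a::real_normed_vector))\<^sup>2"
proof -
  have "(norm (a - b))\<^sup>2 \<le> (norm a + norm b)\<^sup>2"
    by (intro power_mono norm_triangle_ineq4 norm_ge_zero)
  also have "\<dots> \<le> 2 * (norm a)\<^sup>2 + 2 * (norm b)\<^sup>2"
    using sum_power2_ge_zero[of "norm a - norm b" 0] by (simp add: power2_eq_square algebra_simps)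
  finally show ?thesis .
qed

lemma square_integrable_on_diff:
  assumes f: "square_integrable_on M A f" and g: "square_integrable_on M A g"
  shows "square_integrable_on M A (\<lambda>x. f x - g x)"
proof -
  have m: "(\<lambda>x. indicator A x *\<^sub>R (f x - g x)) \<in> borel_measurable M"
    unfolding scaleR_diff_right using f g
    by (intro borel_measurable_diff) (auto simp: square_integrable_on_def set_borel_measurable_def)
  have "set_integrable M A (\<lambda>x. (norm (f x - g x))\<^sup>2)"
    unfolding set_integrable_def
  proof (rule Bochner_Integration.integrable_bound)
    show "integrable M (\<lambda>x. indicator A x *\<^sub>R (2 * (norm (f x))\<^sup>2 + 2 * (norm (g x))\<^sup>2))"
      unfolding scaleR_right_distrib using f g
      by (intro Bochner_Integration.integrable_add)
         (auto simp: square_integrable_on_def set_integrable_def mult.left_commute[of "indicator A _" 2])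
    have "(\<lambda>x. (norm (indicator A x *\<^sub>R (f x - g x)))\<^sup>2) \<in> borel_measurable M"
      by (intro borel_measurable_power measurable_compose[OF m] borel_measurable_continuous_onI continuous_intros)
    then show "(\<lambda>x. indicator A x *\<^sub>R (norm (f x - g x))\<^sup>2) \<in> borel_measurable M"
      by (rule measurable_cong[THEN iffD1, rotated]) (auto simp: indicator_def)
    show "AE x in M. norm (indicat_real A x *\<^sub>R (norm (f x - g x))\<^sup>2)
        \<le> norm (indicat_real A x *\<^sub>R (2 * (norm (f x))\<^sup>2 + 2 * (norm (g x))\<^sup>2))"
      using norm_diff_power2_le by (intro AE_I2) (auto simp: indicator_def)
  qed
  then show ?thesis using m by (simp add: square_integrable_on_def set_borel_measurable_def)
qed

lemma square_integrable_on_cong: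
  assumes "\<And>x. x \<in> A \<Longrightarrow> f x = g x"
  shows "square_integrable_on M A f \<longleftrightarrow> square_integrable_on M A g"
proof -
  have "(\<lambda>x. indicator A x *\<^sub>R f x) = (\<lambda>x. indicator A x *\<^sub>R g x)"
    "(\<lambda>x. indicator A x *\<^sub>R (norm (f x))\<^sup>2) = (\<lambda>x. indicator A x *\<^sub>R (norm (g x))\<^sup>2)"
    using assms by (auto simp: indicator_def fun_eq_iff)
  then show ?thesis
    by (simp add: square_integrable_on_def set_borel_measurable_def set_integrable_def)
qed

lemma AE_normal_component:
  assumes "regular_open K"
  shows "set_borel_measurable hausdorff1 (frontier K) (\<lambda>x. outward_normal K x $ j)"
    and "AE x in hausdorff1. x \<in> frontier K \<longrightarrow> \<bar>outward_normal K x $ j\<bar> \<le> 1"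
proof -
  interpret H: complete_measure "hausdorff1 :: plane measure" by (rule complete_measure_hausdorff1)
  have ae: "AE x in hausdorff1. x \<in> frontier K \<longrightarrow> (\<exists>\<nu>. is_outward_normal K x \<nu>)" and "open K"
    using assms by (auto simp: regular_open_def)
  obtain f where f: "f \<in> borel_measurable borel" "\<And>x \<nu>. is_outward_normal K x \<nu> \<Longrightarrow> f x = \<nu>"
    using outward_normal_measurable[OF \<open>open K\<close>] by blast
  have "(\<lambda>x. f x $ j) \<in> borel_measurable borel"
    by (rule measurable_compose[OF f(1)]) (intro borel_measurable_continuous_onI continuous_intros)
  then have mf: "set_borel_measurable hausdorff1 (frontier K) (\<lambda>x. f x $ j)"
    by (intro set_borel_measurable_borel borel_sets_hausdorff1) auto
  have "AE x in hausdorff1. x \<in> frontier K \<longrightarrow> f x $ j = outward_normal K x $ j"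
    using ae by eventually_elim (auto simp: f(2) outward_normal_eq)
  from H.set_borel_measurable_cong_AE_iff[OF this] mf
  show "set_borel_measurable hausdorff1 (frontier K) (\<lambda>x. outward_normal K x $ j)" by simp
  show "AE x in hausdorff1. x \<in> frontier K \<longrightarrow> \<bar>outward_normal K x $ j\<bar> \<le> 1"
    using ae
  proof eventually_elim
    case (elim x)
    show ?case
    proof
      assume "x \<in> frontier K"
      then obtain \<nu> where \<nu>: "is_outward_normal K x \<nu>" using elim by blast
      show "\<bar>outward_normal K x $ j\<bar> \<le> 1"
        using component_le_norm_cart[of \<nu> j] is_outward_normal_norm[OF \<nu>]
        unfolding outward_normal_eq[OF \<nu>] by simp
    qed
  qed
qed

lemma set_integrable_boundary:
  assumes K: "regular_open K" and t: "square_integrable_on hausdorff1 (frontier K) t"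
  shows "set_integrable hausdorff1 (frontier K) t"
    and "set_integrable hausdorff1 (frontier K) (\<lambda>x. outward_normal K x $ j *\<^sub>R t x)"
proof -
  show *: "set_integrable hausdorff1 (frontier K) t"
    using K t by (intro set_integrable_if_square_integrable) (auto simp: regular_open_def)
  show "set_integrable hausdorff1 (frontier K) (\<lambda>x. outward_normal K x $ j *\<^sub>R t x)"
    by (rule set_integrable_bdd_scale[OF * AE_normal_component[OF K]])
qed

text \<open>The form in which the fundamental lemma is applied: densities living on several curves that
  may overlap. It gives uniqueness of traces (one curve) as well as the matching conditions
  between the elements of a mesh (all element boundaries against the boundary of the domain).\<close>

lemma AE_sum_eq_if_C1_test:
  fixes F :: "'i \<Rightarrow> plane \<Rightarrow> 'b::{banach, second_countable_topology}"
  assumes "finite I"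
    and A: "\<And>i. i \<in> I \<Longrightarrow> A i \<in> sets hausdorff1 \<and> bounded (A i) \<and> emeasure hausdorff1 (A i) < \<infinity>"
    and F: "\<And>i. i \<in> I \<Longrightarrow> set_integrable hausdorff1 (A i) (F i)"
    and B: "B \<in> sets hausdorff1" "bounded B" "emeasure hausdorff1 B < \<infinity>"
    and G: "set_integrable hausdorff1 B G"
    and test: "\<And>\<phi> :: plane \<Rightarrow> real. C1_on UNIV \<phi> \<Longrightarrow>
      (\<Sum>i\<in>I. LINT x:A i|hausdorff1. \<phi> x *\<^sub>R F i x) = (LINT x:B|hausdorff1. \<phi> x *\<^sub>R G x)"
  shows "AE x in hausdorff1. (\<Sum>i\<in>I. indicator (A i) x *\<^sub>R F i x) = indicator B x *\<^sub>R G x"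
proof -
  let ?H = "hausdorff1 :: plane measure"
  let ?f = "\<lambda>x. (\<Sum>i\<in>I. indicator (A i) x *\<^sub>R F i x) - indicator B x *\<^sub>R G x"
  have "AE x in ?H. ?f x = 0"
  proof (rule integrable_zero_if_C1_test[where S = "(\<Union>i\<in>I. A i) \<union> B"])
    show "(\<Union>i\<in>I. A i) \<union> B \<in> sets ?H" using assms by (intro sets.Un sets.finite_UN) auto
    have "emeasure ?H ((\<Union>i\<in>I. A i) \<union> B) \<le> (\<Sum>i\<in>I. emeasure ?H (A i)) + emeasure ?H B"
      using assms by (intro order_trans[OF emeasure_subadditive] add_mono emeasure_subadditive_finite) auto
    also have "\<dots> < \<infinity>" using assms by (auto simp: less_top)
    finally show "emeasure ?H ((\<Union>i\<in>I. A i) \<union> B) < \<infinity>" .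
    show "integrable ?H ?f"
      using F G by (intro Bochner_Integration.integrable_diff Bochner_Integration.integrable_sum) (auto simp: set_integrable_def)
    show "?f x = 0" if "x \<notin> (\<Union>i\<in>I. A i) \<union> B" for x
      using that by simp
    fix \<phi> :: "plane \<Rightarrow> real" assume \<phi>: "C1_on UNIV \<phi>"
    have sc: "set_integrable ?H C (\<lambda>x. \<phi> x *\<^sub>R h x)"
      if "set_integrable ?H C h" "C \<in> sets ?H" "bounded C" for C and h :: "plane \<Rightarrow> 'b"
      using that \<phi> by (intro set_integrable_continuous_scale borel_sets_hausdorff1 C1_on_continuous_on) auto
    have "(LINT x|?H. \<phi> x *\<^sub>R ?f x) =
      (LINT x|?H. (\<Sum>i\<in>I. indicator (A i) x *\<^sub>R \<phi> x *\<^sub>R F i x) - indicator B x *\<^sub>R \<phi> x *\<^sub>R G x)"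
      by (simp add: scaleR_diff_right scaleR_sum_right mult.commute)
    also have "\<dots> = (\<Sum>i\<in>I. LINT x:A i|?H. \<phi> x *\<^sub>R F i x) - (LINT x:B|?H. \<phi> x *\<^sub>R G x)"
      unfolding set_lebesgue_integral_def using sc[OF F] sc[OF G] A B
      by (subst Bochner_Integration.integral_diff) (auto simp: set_integrable_def)
    finally show "(LINT x|?H. \<phi> x *\<^sub>R ?f x) = 0" using test[OF \<phi>] by simp
  qed
  then show ?thesis by simp
qed

lemma AE_eq_if_C1_test_frontier:
  assumes K: "regular_open K"
    and f: "set_integrable hausdorff1 (frontier K) f" and g: "set_integrable hausdorff1 (frontier K) g"
    and test: "\<And>\<phi> :: plane \<Rightarrow> real. C1_on UNIV \<phi> \<Longrightarrow>
      (LINT x:frontier K|hausdorff1. \<phi> x *\<^sub>R f x) = (LINT x:frontier K|hausdorff1. \<phi> x *\<^sub>R g x)"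
  shows "AE x in hausdorff1. x \<in> frontier K \<longrightarrow> f x = (g x :: complex)"
proof -
  have "AE x in hausdorff1. (\<Sum>i\<in>{K}. indicator (frontier i) x *\<^sub>R f x) = indicator (frontier K) x *\<^sub>R g x"
    by (rule AE_sum_eq_if_C1_test) (use assms in \<open>auto simp: regular_open_def compact_imp_bounded[OF compact_frontier_bounded]\<close>)
  then show ?thesis by eventually_elim (auto simp: indicator_def split: if_splits)
qed

lemma is_trace_test:
  "is_trace K w t \<Longrightarrow> C1_on UNIV \<phi> \<Longrightarrow>
    (LINT x:frontier K|hausdorff1. \<phi> x *\<^sub>R (outward_normal K x $ j *\<^sub>R t x)) =
    (LINT y:K|lebesgue. \<phi> y *\<^sub>R pderiv2 j w y + pderiv2 j \<phi> y *\<^sub>R w y)"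
  by (simp add: is_trace_def)

lemma is_normal_derivative_test:
  "is_normal_derivative K w s \<Longrightarrow> C1_on UNIV \<phi> \<Longrightarrow>
    (LINT x:frontier K|hausdorff1. \<phi> x *\<^sub>R s x) =
    (LINT y:K|lebesgue. (\<Sum>j\<in>UNIV. pderiv2 j \<phi> y *\<^sub>R pderiv2 j w y) + \<phi> y *\<^sub>R laplacian w y)"
  by (simp add: is_normal_derivative_def)

lemma scaled_normal_cancel:
  assumes "is_outward_normal K x \<nu>" "\<And>j. \<nu> $ j *\<^sub>R a = \<nu> $ j *\<^sub>R (b::complex)"
  shows "a = b"
proof -
  have "\<nu> \<noteq> 0" using is_outward_normal_norm[OF assms(1)] by auto
  then obtain j where "\<nu> $ j \<noteq> 0" by (auto simp: vec_eq_iff)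
  then show ?thesis using assms(2)[of j] by simp
qed

text \<open>Testing determines the components of \<open>n t\<close>, and \<open>n\<close> is a unit vector.\<close>

lemma is_trace_unique:
  assumes K: "regular_open K" and t: "is_trace K w t" and s: "is_trace K w s"
  shows "AE x in hausdorff1. x \<in> frontier K \<longrightarrow> t x = s x"
proof -
  have "AE x in hausdorff1. x \<in> frontier K \<longrightarrow>
      outward_normal K x $ j *\<^sub>R t x = outward_normal K x $ j *\<^sub>R s x" for j
    using t s by (intro AE_eq_if_C1_test_frontier[OF K] set_integrable_boundary(2)[OF K])
      (auto simp: is_trace_test[OF t] is_trace_test[OF s] is_trace_def simp del: scaleR_scaleR)
  then have "AE x in hausdorff1. \<forall>j. x \<in> frontier K \<longrightarrow>
      outward_normal K x $ j *\<^sub>R t x = outward_normal K x $ j *\<^sub>R s x"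
    by (intro AE_all_countable[THEN iffD2] allI)
  moreover have "AE x in hausdorff1. x \<in> frontier K \<longrightarrow> (\<exists>\<nu>. is_outward_normal K x \<nu>)"
    using K by (simp add: regular_open_def)
  ultimately show ?thesis
    by eventually_elim (metis outward_normal_eq scaled_normal_cancel)
qed

lemma is_normal_derivative_unique:
  assumes K: "regular_open K" and t: "is_normal_derivative K w t" and s: "is_normal_derivative K w s"
  shows "AE x in hausdorff1. x \<in> frontier K \<longrightarrow> t x = s x"
  using t s by (intro AE_eq_if_C1_test_frontier[OF K] set_integrable_boundary(1)[OF K])
    (auto simp: is_normal_derivative_test[OF t] is_normal_derivative_test[OF s] is_normal_derivative_def)

lemma pderiv2_diff:
  assumes "u differentiable (at x)" "v differentiable (at x)"
  shows "pderiv2 j (\<lambda>x. u x - v x) x = pderiv2 j u x - pderiv2 j v x"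
proof -
  have "((\<lambda>x. u x - v x) has_derivative (\<lambda>h. frechet_derivative u (at x) h - frechet_derivative v (at x) h)) (at x)"
    using assms by (intro has_derivative_diff) (auto simp: frechet_derivative_works[symmetric])
  from frechet_derivative_at[OF this, symmetric] show ?thesis by (simp add: pderiv2_def)
qed

lemma differentiable_cong_open:
  assumes "open K" "x \<in> K" "\<And>y. y \<in> K \<Longrightarrow> f y = g y"
  shows "f differentiable (at x) \<longleftrightarrow> g differentiable (at x)"
  using assms unfolding differentiable_def
  by (metis has_derivative_transform_within_open)

lemma pderiv2_cong_open:
  assumes "open K" "x \<in> K" "\<And>y. y \<in> K \<Longrightarrow> f y = g y"
  shows "pderiv2 j f x = pderiv2 j g x"
proof -
  have "(f has_derivative D) (at x) \<longleftrightarrow> (g has_derivative D) (at x)" for D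
    using has_derivative_transform_within_open[of f D x UNIV K g]
      has_derivative_transform_within_open[of g D x UNIV K f] assms by auto
  then show ?thesis by (simp add: pderiv2_def frechet_derivative_def)
qed

lemma C1_on_cong_open:
  assumes "open K" "\<And>y. y \<in> K \<Longrightarrow> f y = g y"
  shows "C1_on K f \<longleftrightarrow> C1_on K g"
proof -
  have "continuous_on K (pderiv2 j f) \<longleftrightarrow> continuous_on K (pderiv2 j g)" for j
    using pderiv2_cong_open[OF assms(1) _ assms(2)] by (intro continuous_on_cong) auto
  then show ?thesis
    using differentiable_cong_open[OF assms(1) _ assms(2)] by (auto simp: C1_on_def)
qed

lemma C1_on_diff:
  assumes "open K" "C1_on K u" "C1_on K v"
  shows "C1_on K (\<lambda>x. u x - v x)"
proof -
  have "pderiv2 j (\<lambda>x. u x - v x) x = pderiv2 j u x - pderiv2 j v x" if "x \<in> K" for j x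
    using assms that by (intro pderiv2_diff) (auto simp: C1_on_def)
  then have "continuous_on K (pderiv2 j (\<lambda>x. u x - v x)) \<longleftrightarrow> continuous_on K (\<lambda>x. pderiv2 j u x - pderiv2 j v x)" for j
    by (intro continuous_on_cong) auto
  then show ?thesis using assms by (auto simp: C1_on_def intro: differentiable_diff continuous_on_diff)
qed

lemma C2_on_diff:
  assumes K: "open K" and u: "C2_on K u" and v: "C2_on K v"
  shows "C2_on K (\<lambda>x. u x - v x)"
    and "x \<in> K \<Longrightarrow> laplacian (\<lambda>x. u x - v x) x = laplacian u x - laplacian v x"
proof -
  have d: "pderiv2 j (\<lambda>x. u x - v x) x = pderiv2 j u x - pderiv2 j v x" if "x \<in> K" for j x
    using u v that by (intro pderiv2_diff) (auto simp: C1_on_def C2_on_def)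
  have "C1_on K (pderiv2 j (\<lambda>x. u x - v x)) \<longleftrightarrow> C1_on K (\<lambda>x. pderiv2 j u x - pderiv2 j v x)" for j
    by (rule C1_on_cong_open[OF K d])
  moreover have "C1_on K (\<lambda>x. pderiv2 j u x - pderiv2 j v x)" for j
    using u v by (intro C1_on_diff[OF K]) (auto simp: C2_on_def)
  ultimately show "C2_on K (\<lambda>x. u x - v x)" using u v C1_on_diff[OF K] by (auto simp: C2_on_def)
  assume x: "x \<in> K"
  have "pderiv2 j (pderiv2 j (\<lambda>x. u x - v x)) x = pderiv2 j (\<lambda>x. pderiv2 j u x - pderiv2 j v x) x" for j
    by (rule pderiv2_cong_open[OF K x d])
  moreover have "pderiv2 j (\<lambda>x. pderiv2 j u x - pderiv2 j v x) x = pderiv2 j (pderiv2 j u) x - pderiv2 j (pderiv2 j v) x" for j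
    using u v x by (intro pderiv2_diff) (auto simp: C2_on_def C1_on_def)
  ultimately show "laplacian (\<lambda>x. u x - v x) x = laplacian u x - laplacian v x"
    by (simp add: laplacian_def sum_subtractf)
qed

lemma borel_sets_lebesgue: "sets borel \<subseteq> sets lebesgue"
  by auto

lemma C1_on_pderiv2_continuous: "C1_on UNIV \<phi> \<Longrightarrow> continuous_on UNIV (pderiv2 j \<phi>)"
  by (simp add: C1_on_def)

lemma helmholtz_field_integrable:
  assumes u: "helmholtz_field \<kappa> K u" and K: "open K" "bounded K"
  shows "set_integrable lebesgue K u" "set_integrable lebesgue K (pderiv2 j u)"
    "set_integrable lebesgue K (laplacian u)"
proof -
  have *: "K \<in> sets lebesgue" "emeasure lebesgue K < \<infinity>"
    using K emeasure_bounded_finite[of K] by auto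
  show iu: "set_integrable lebesgue K u" and "set_integrable lebesgue K (pderiv2 j u)"
    using u * by (auto simp: helmholtz_field_def intro!: set_integrable_if_square_integrable)
  have "laplacian u x = - of_real (\<kappa>\<^sup>2) * u x" if "x \<in> K" for x
    using u that by (simp add: helmholtz_field_def eq_neg_iff_add_eq_0)
  moreover have "set_integrable lebesgue K (\<lambda>x. - of_real (\<kappa>\<^sup>2) * u x)"
    using iu by (intro set_integrable_mult_right)
  ultimately show "set_integrable lebesgue K (laplacian u)"
    by (subst set_integrable_cong[OF refl]) auto
qed

lemma helmholtz_field_test_integrable:
  fixes \<phi> :: "plane \<Rightarrow> real"
  assumes u: "helmholtz_field \<kappa> K u" and K: "open K" "bounded K" and \<phi>: "C1_on UNIV \<phi>"
  shows "set_integrable lebesgue K (\<lambda>y. \<phi> y *\<^sub>R pderiv2 j u y + pderiv2 j \<phi> y *\<^sub>R u y)"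
    and "set_integrable lebesgue K (\<lambda>y. (\<Sum>j\<in>UNIV. pderiv2 j \<phi> y *\<^sub>R pderiv2 j u y) + \<phi> y *\<^sub>R laplacian u y)"
proof -
  note i = helmholtz_field_integrable[OF u K]
  have s: "set_integrable lebesgue K (\<lambda>y. c y *\<^sub>R h y)"
    if "continuous_on UNIV c" "set_integrable lebesgue K h" for c and h :: "plane \<Rightarrow> complex"
    using that K by (intro set_integrable_continuous_scale borel_sets_lebesgue) auto
  note c = C1_on_continuous_on[OF \<phi>] C1_on_pderiv2_continuous[OF \<phi>]
  show "set_integrable lebesgue K (\<lambda>y. \<phi> y *\<^sub>R pderiv2 j u y + pderiv2 j \<phi> y *\<^sub>R u y)"
    by (intro set_integral_add s c i)
  show "set_integrable lebesgue K (\<lambda>y. (\<Sum>j\<in>UNIV. pderiv2 j \<phi> y *\<^sub>R pderiv2 j u y) + \<phi> y *\<^sub>R laplacian u y)"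
    unfolding sum_2 by (intro set_integral_add s c i)
qed

lemma is_trace_diff:
  assumes K: "regular_open K" and u: "helmholtz_field \<kappa> K u" and v: "helmholtz_field \<kappa> K v"
    and t: "is_trace K u t" and s: "is_trace K v s"
  shows "is_trace K (\<lambda>x. u x - v x) (\<lambda>x. t x - s x)"
  unfolding is_trace_def
proof (intro conjI allI impI)
  have oK: "open K" "bounded K" using K by (auto simp: regular_open_def)
  have ts: "square_integrable_on hausdorff1 (frontier K) t" "square_integrable_on hausdorff1 (frontier K) s"
    using t s by (auto simp: is_trace_def)
  then show "square_integrable_on hausdorff1 (frontier K) (\<lambda>x. t x - s x)" by (rule square_integrable_on_diff)
  fix \<phi> :: "plane \<Rightarrow> real" and j assume \<phi>: "C1_on UNIV \<phi>"
  let ?F = "\<lambda>w y. \<phi> y *\<^sub>R pderiv2 j w y + pderiv2 j \<phi> y *\<^sub>R w y"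
  have b: "set_integrable hausdorff1 (frontier K) (\<lambda>x. (\<phi> x * outward_normal K x $ j) *\<^sub>R r x)"
    if "square_integrable_on hausdorff1 (frontier K) r" for r :: "plane \<Rightarrow> complex"
    unfolding scaleR_scaleR[symmetric]
    using oK(2) by (intro set_integrable_continuous_scale borel_sets_hausdorff1 C1_on_continuous_on[OF \<phi>]
        set_integrable_boundary(2)[OF K that]) (auto intro: compact_imp_bounded[OF compact_frontier_bounded])
  have "(LINT y:K|lebesgue. ?F (\<lambda>x. u x - v x) y) = (LINT y:K|lebesgue. ?F u y - ?F v y)"
    using u v oK
    by (intro set_lebesgue_integral_cong)
       (auto simp: pderiv2_diff helmholtz_field_def C1_on_def C2_on_def algebra_simps)
  also have "\<dots> = (LINT y:K|lebesgue. ?F u y) - (LINT y:K|lebesgue. ?F v y)"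
    by (intro set_integral_diff helmholtz_field_test_integrable(1)[OF u oK \<phi>] helmholtz_field_test_integrable(1)[OF v oK \<phi>])
  also have "\<dots> = (LINT x:frontier K|hausdorff1. (\<phi> x * outward_normal K x $ j) *\<^sub>R t x)
      - (LINT x:frontier K|hausdorff1. (\<phi> x * outward_normal K x $ j) *\<^sub>R s x)"
    using t s \<phi> by (simp add: is_trace_def)
  also have "\<dots> = (LINT x:frontier K|hausdorff1. (\<phi> x * outward_normal K x $ j) *\<^sub>R (t x - s x))"
    unfolding scaleR_diff_right by (intro set_integral_diff(2)[symmetric] b ts)
  finally show "(LINT y:K|lebesgue. ?F (\<lambda>x. u x - v x) y) =
    (LINT x:frontier K|hausdorff1. (\<phi> x * outward_normal K x $ j) *\<^sub>R (t x - s x))" .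
qed

lemma is_normal_derivative_diff:
  assumes K: "regular_open K" and u: "helmholtz_field \<kappa> K u" and v: "helmholtz_field \<kappa> K v"
    and t: "is_normal_derivative K u t" and s: "is_normal_derivative K v s"
  shows "is_normal_derivative K (\<lambda>x. u x - v x) (\<lambda>x. t x - s x)"
  unfolding is_normal_derivative_def
proof (intro conjI allI impI)
  have oK: "open K" "bounded K" using K by (auto simp: regular_open_def)
  have ts: "square_integrable_on hausdorff1 (frontier K) t" "square_integrable_on hausdorff1 (frontier K) s"
    using t s by (auto simp: is_normal_derivative_def)
  then show "square_integrable_on hausdorff1 (frontier K) (\<lambda>x. t x - s x)" by (rule square_integrable_on_diff)
  fix \<phi> :: "plane \<Rightarrow> real" assume \<phi>: "C1_on UNIV \<phi>"
  let ?F = "\<lambda>w y. (\<Sum>j\<in>UNIV. pderiv2 j \<phi> y *\<^sub>R pderiv2 j w y) + \<phi> y *\<^sub>R laplacian w y"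
  have b: "set_integrable hausdorff1 (frontier K) (\<lambda>x. \<phi> x *\<^sub>R r x)"
    if "square_integrable_on hausdorff1 (frontier K) r" for r :: "plane \<Rightarrow> complex"
    using oK(2) by (intro set_integrable_continuous_scale borel_sets_hausdorff1 C1_on_continuous_on[OF \<phi>]
        set_integrable_boundary(1)[OF K that]) (auto intro: compact_imp_bounded[OF compact_frontier_bounded])
  have C2: "C2_on K u" "C2_on K v" using u v by (auto simp: helmholtz_field_def)
  then have "(LINT y:K|lebesgue. ?F (\<lambda>x. u x - v x) y) = (LINT y:K|lebesgue. ?F u y - ?F v y)"
    using oK
    by (intro set_lebesgue_integral_cong)
       (auto simp: pderiv2_diff C2_on_diff(2) C1_on_def C2_on_def sum_2 algebra_simps)
  also have "\<dots> = (LINT y:K|lebesgue. ?F u y) - (LINT y:K|lebesgue. ?F v y)"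
    by (intro set_integral_diff helmholtz_field_test_integrable(2)[OF u oK \<phi>] helmholtz_field_test_integrable(2)[OF v oK \<phi>])
  also have "\<dots> = (LINT x:frontier K|hausdorff1. \<phi> x *\<^sub>R t x) - (LINT x:frontier K|hausdorff1. \<phi> x *\<^sub>R s x)"
    using t s \<phi> by (simp add: is_normal_derivative_def)
  also have "\<dots> = (LINT x:frontier K|hausdorff1. \<phi> x *\<^sub>R (t x - s x))"
    unfolding scaleR_diff_right by (intro set_integral_diff(2)[symmetric] b ts)
  finally show "(LINT y:K|lebesgue. ?F (\<lambda>x. u x - v x) y) =
    (LINT x:frontier K|hausdorff1. \<phi> x *\<^sub>R (t x - s x))" .
qed

lemma is_trace_trace_on: "helmholtz_field \<kappa> K u \<Longrightarrow> is_trace K u (trace_on K u)"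
  unfolding trace_on_def helmholtz_field_def by (metis someI_ex)

lemma is_normal_derivative_normal_derivative:
  "helmholtz_field \<kappa> K u \<Longrightarrow> is_normal_derivative K u (normal_derivative K u)"
  unfolding normal_derivative_def helmholtz_field_def by (metis someI_ex)

lemma helmholtz_field_diff:
  assumes K: "regular_open K" and u: "helmholtz_field \<kappa> K u" and v: "helmholtz_field \<kappa> K v"
  shows "helmholtz_field \<kappa> K (\<lambda>x. u x - v x)"
  unfolding helmholtz_field_def
proof (intro conjI ballI allI)
  have oK: "open K" using K by (simp add: regular_open_def)
  have C2: "C2_on K u" "C2_on K v" using u v by (auto simp: helmholtz_field_def)
  show "C2_on K (\<lambda>x. u x - v x)" using C2_on_diff(1)[OF oK C2] .
  show "laplacian (\<lambda>x. u x - v x) x + of_real (\<kappa>\<^sup>2) * (u x - v x) = 0" if "x \<in> K" for x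
  proof -
    have "laplacian u x = - (of_real (\<kappa>\<^sup>2) * u x)" "laplacian v x = - (of_real (\<kappa>\<^sup>2) * v x)"
      using u v that by (auto simp: helmholtz_field_def eq_neg_iff_add_eq_0)
    then show ?thesis unfolding C2_on_diff(2)[OF oK C2 that] by (simp add: algebra_simps)
  qed
  show "square_integrable_on lebesgue K (\<lambda>x. u x - v x)"
    using u v by (intro square_integrable_on_diff) (auto simp: helmholtz_field_def)
  show "square_integrable_on lebesgue K (pderiv2 j (\<lambda>x. u x - v x))" for j
  proof -
    have "square_integrable_on lebesgue K (\<lambda>x. pderiv2 j u x - pderiv2 j v x)"
      using u v by (intro square_integrable_on_diff) (auto simp: helmholtz_field_def)
    then show ?thesis
      using C2 by (subst square_integrable_on_cong[OF pderiv2_diff]) (auto simp: C2_on_def C1_on_def)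
  qed
  show "\<exists>t. is_trace K (\<lambda>x. u x - v x) t"
    using is_trace_diff[OF K u v is_trace_trace_on[OF u] is_trace_trace_on[OF v]] by blast
  show "\<exists>s. is_normal_derivative K (\<lambda>x. u x - v x) s"
    using is_normal_derivative_diff[OF K u v is_normal_derivative_normal_derivative[OF u]
        is_normal_derivative_normal_derivative[OF v]] by blast
qed

text \<open>The choice made in \<^const>\<open>trace_on\<close> respects differences up to null sets, by uniqueness.\<close>

lemma trace_on_diff:
  assumes K: "regular_open K" and u: "helmholtz_field \<kappa> K u" and v: "helmholtz_field \<kappa> K v"
  shows "AE x in hausdorff1. x \<in> frontier K \<longrightarrow> trace_on K (\<lambda>x. u x - v x) x = trace_on K u x - trace_on K v x"
  by (rule is_trace_unique[OF K is_trace_trace_on[OF helmholtz_field_diff[OF K u v]]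
        is_trace_diff[OF K u v is_trace_trace_on[OF u] is_trace_trace_on[OF v]]])

lemma normal_derivative_diff:
  assumes K: "regular_open K" and u: "helmholtz_field \<kappa> K u" and v: "helmholtz_field \<kappa> K v"
  shows "AE x in hausdorff1. x \<in> frontier K \<longrightarrow>
    normal_derivative K (\<lambda>x. u x - v x) x = normal_derivative K u x - normal_derivative K v x"
  by (rule is_normal_derivative_unique[OF K
        is_normal_derivative_normal_derivative[OF helmholtz_field_diff[OF K u v]]
        is_normal_derivative_diff[OF K u v is_normal_derivative_normal_derivative[OF u]
          is_normal_derivative_normal_derivative[OF v]]])

section \<open>Meshes of Lipschitz domains\<close>

text \<open>Below a Lipschitz graph there is a cone with nonempty interior; of two independent directions
  in it at least one is not orthogonal to \<open>\<nu>\<close>.\<close>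

lemma lipschitz_domain_exterior_directions:
  assumes "lipschitz_domain \<Omega>" and x: "x \<in> frontier \<Omega>" and \<nu>: "\<nu> \<noteq> 0"
  obtains h where "h \<bullet> \<nu> \<noteq> 0" "eventually (\<lambda>t. x + t *\<^sub>R h \<notin> \<Omega>) (at_right (0::real))"
proof -
  have op: "open \<Omega>" using assms(1) by (simp add: lipschitz_domain_def)
  obtain T :: "plane \<Rightarrow> plane" and r L :: real and \<phi> :: "real \<Rightarrow> real"
    where T: "orthogonal_transformation T" and r: "r > 0" and L: "L-lipschitz_on UNIV \<phi>"
      and chart: "\<And>y. y \<in> ball x r \<Longrightarrow> y \<in> \<Omega> \<longleftrightarrow> \<phi> (T (y - x) $ 1) < T (y - x) $ 2"
    using assms(1) x unfolding lipschitz_domain_def by metis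
  have lin: "linear T" using T by (rule orthogonal_transformation_linear)
  have L0: "L \<ge> 0" using L by (rule lipschitz_on_nonneg)
  have "x \<notin> \<Omega>" using x op by (simp add: frontier_def interior_open)
  then have \<phi>0: "\<phi> 0 \<ge> 0" using chart[of x] r lin by (simp add: linear_0)
  have ext: "eventually (\<lambda>t. x + t *\<^sub>R h \<notin> \<Omega>) (at_right 0)" if h: "T h $ 2 \<le> - (L * \<bar>T h $ 1\<bar>)" for h
  proof -
    define \<delta> where "\<delta> = r / (norm h + 1)"
    have h1: "norm h + 1 > 0" using norm_ge_zero[of h] by linarith
    have "\<delta> > 0" using r h1 by (simp add: \<delta>_def)
    then show ?thesis
    proof (rule eventually_at_rightI[rotated])
      fix t assume t: "t \<in> {0<..<\<delta>}"
      have "t * norm h \<le> t * (norm h + 1)" using t by simp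
      also have "\<dots> < r" using t h1 by (simp add: \<delta>_def field_simps)
      finally have b: "x + t *\<^sub>R h \<in> ball x r" using t by (simp add: dist_norm)
      have Th: "T (t *\<^sub>R h) = t *\<^sub>R T h" by (rule linear_cmul[OF lin])
      have "\<bar>\<phi> (t * T h $ 1) - \<phi> 0\<bar> \<le> L * \<bar>t * T h $ 1\<bar>"
        using lipschitz_onD[OF L, of "t * T h $ 1" 0] by (simp add: dist_real_def)
      then have "\<phi> (t * T h $ 1) \<ge> - (L * \<bar>t * T h $ 1\<bar>)" using \<phi>0 by linarith
      moreover have "t * (T h $ 2) \<le> t * (- (L * \<bar>T h $ 1\<bar>))" using h t by (intro mult_left_mono) auto
      ultimately show "x + t *\<^sub>R h \<notin> \<Omega>"
        using chart[OF b] t by (simp add: Th abs_mult mult.left_commute)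
    qed
  qed
  have sur: "\<exists>h. T h = y" for y using orthogonal_transformation_surj[OF T] by (metis surjD)
  obtain a where a: "T a = axis 2 (- (L + 1))" using sur by blast
  \<comment> \<open>In local coordinates \<open>a = (0, - L - 1)\<close> and \<open>b = (1, - L - 1)\<close>, both below the graph of \<open>- L \<bar>s\<bar>\<close>.\<close>
  obtain b where b: "T b = axis 1 1 + axis 2 (- (L + 1))" using sur by blast
  have "T a $ 1 = 0" "T a $ 2 = - (L + 1)" "T b $ 1 = 1" "T b $ 2 = - (L + 1)"
    by (auto simp: a b axis_def)
  then have exa: "eventually (\<lambda>t. x + t *\<^sub>R a \<notin> \<Omega>) (at_right 0)" and exb: "eventually (\<lambda>t. x + t *\<^sub>R b \<notin> \<Omega>) (at_right 0)"
    using L0 by (auto intro!: ext)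
  have "a \<bullet> \<nu> \<noteq> 0 \<or> b \<bullet> \<nu> \<noteq> 0"
  proof (rule ccontr)
    assume "\<not> ?thesis"
    then have "T a \<bullet> T \<nu> = 0" "T b \<bullet> T \<nu> = 0"
      using T by (auto simp: orthogonal_transformation_def)
    then have "T \<nu> $ 2 = 0" "T \<nu> $ 1 = 0"
      using L0 by (auto simp: a b inner_add_left inner_axis')
    then have "norm (T \<nu>) = 0" by (simp add: vec_eq_iff forall_2)
    then show False using \<nu> orthogonal_transformation_norm[OF T] by simp
  qed
  then show ?thesis using exa exb that by blast
qed

locale domain_mesh =
  fixes \<Omega> :: "plane set" and \<T> :: "plane set set"
  assumes lipschitz: "lipschitz_domain \<Omega>" and bounded: "bounded \<Omega>" and mesh: "mesh_of \<Omega> \<T>"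
begin

lemma finite_mesh: "finite \<T>" and disjoint_mesh: "K \<in> \<T> \<Longrightarrow> K' \<in> \<T> \<Longrightarrow> K \<noteq> K' \<Longrightarrow> K \<inter> K' = {}"
  and closure_mesh: "(\<Union>K\<in>\<T>. closure K) = closure \<Omega>"
  and element: "K \<in> \<T> \<Longrightarrow> open K" "K \<in> \<T> \<Longrightarrow> K \<subseteq> \<Omega>"
  using mesh by (auto simp: mesh_of_def disjoint_def)

lemma open_domain: "open \<Omega>"
  using lipschitz by (simp add: lipschitz_domain_def)

lemma regular_element: "K \<in> \<T> \<Longrightarrow> regular_open K"
  using mesh bounded by (auto simp: mesh_of_def regular_open_def intro: bounded_subset)

definition good_point :: "plane \<Rightarrow> bool" where
  "good_point x \<longleftrightarrow> (\<forall>K\<in>\<T>. x \<in> frontier K \<longrightarrow> (\<exists>\<nu>. is_outward_normal K x \<nu>))"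

lemma AE_good_point: "AE x in hausdorff1. good_point x"
  using regular_element unfolding good_point_def
  by (intro AE_finite_allI[OF finite_mesh]) (auto simp: regular_open_def)

lemma good_point_opposite:
  assumes "good_point x" "K \<in> \<T>" "K' \<in> \<T>" "K \<noteq> K'" "x \<in> frontier K" "x \<in> frontier K'"
  obtains \<nu> where "is_outward_normal K x \<nu>" "is_outward_normal K' x (- \<nu>)"
proof -
  obtain \<nu> \<nu>' where \<nu>: "is_outward_normal K x \<nu>" "is_outward_normal K' x \<nu>'"
    using assms unfolding good_point_def by blast
  then show ?thesis
    using that is_outward_normal_opposite[OF \<nu> disjoint_mesh[OF assms(2-4)]] by simp
qed

text \<open>Normals of disjoint elements are opposite, and three vectors cannot be pairwise opposite.\<close>

lemma good_point_elements_eq: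
  assumes x: "good_point x" and K: "K \<in> \<T>" "K' \<in> \<T>" "K \<noteq> K'" "x \<in> frontier K" "x \<in> frontier K'"
  shows "{K\<in>\<T>. x \<in> frontier K} = {K, K'}"
proof -
  have False if L: "L \<in> \<T>" "L \<noteq> K" "L \<noteq> K'" "x \<in> frontier L" for L
  proof -
    obtain \<nu> where \<nu>: "is_outward_normal K x \<nu>" "is_outward_normal K' x (- \<nu>)"
      using good_point_opposite[OF x K] .
    obtain \<mu> where \<mu>: "is_outward_normal L x \<mu>" using L x by (auto simp: good_point_def)
    have "\<mu> = - \<nu>" "\<mu> = - (- \<nu>)"
      using is_outward_normal_opposite[OF \<nu>(1) \<mu>] is_outward_normal_opposite[OF \<nu>(2) \<mu>]
        disjoint_mesh K L by auto
    then have "\<nu> = - \<nu>" by simp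
    then have "\<nu> $ i = - (\<nu> $ i)" for i by (metis vector_uminus_component)
    then have "\<nu> = 0" by (simp add: vec_eq_iff)
    then show False using is_outward_normal_norm[OF \<nu>(1)] by simp
  qed
  then show ?thesis using K by auto
qed

text \<open>Two elements with opposite normals fill every direction that is not tangential, which leaves
  no room for the exterior cone of the Lipschitz domain. So interior edges meet the boundary of the
  domain only in a null set.\<close>

lemma good_point_boundary_unique:
  assumes x: "good_point x" and b: "x \<in> frontier \<Omega>"
    and K: "K \<in> \<T>" "K' \<in> \<T>" "x \<in> frontier K" "x \<in> frontier K'"
  shows "K = K'"
proof (rule ccontr)
  assume ne: "K \<noteq> K'"
  obtain \<nu> where \<nu>: "is_outward_normal K x \<nu>" "is_outward_normal K' x (- \<nu>)"
    using good_point_opposite[OF x K(1,2) ne K(3,4)] .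
  have "\<nu> \<noteq> 0" using is_outward_normal_norm[OF \<nu>(1)] by auto
  then obtain h where h: "h \<bullet> \<nu> \<noteq> 0" and out: "eventually (\<lambda>t. x + t *\<^sub>R h \<notin> \<Omega>) (at_right (0::real))"
    using lipschitz_domain_exterior_directions[OF lipschitz b] by blast
  have "h \<bullet> \<nu> < 0 \<or> h \<bullet> (- \<nu>) < 0" using h by auto
  then have "eventually (\<lambda>t. x + t *\<^sub>R h \<in> \<Omega>) (at_right (0::real))"
    using is_outward_normal_radial(1)[OF \<nu>(1), of h] is_outward_normal_radial(1)[OF \<nu>(2), of h]
      element(2)[OF K(1)] element(2)[OF K(2)]
    by (auto intro: eventually_mono)
  with out have "eventually (\<lambda>t. False) (at_right (0::real))" by eventually_elim simp
  then show False by simp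
qed

lemma frontier_domain_element:
  assumes "x \<in> frontier \<Omega>"
  obtains K where "K \<in> \<T>" "x \<in> frontier K"
proof -
  have x: "x \<in> closure \<Omega>" "x \<notin> \<Omega>" using assms open_domain by (auto simp: frontier_def interior_open)
  then obtain K where "K \<in> \<T>" "x \<in> closure K" using closure_mesh by blast
  moreover have "x \<notin> K" using element(2)[OF \<open>K \<in> \<T>\<close>] x by blast
  ultimately show ?thesis using that element(1) by (auto simp: frontier_def interior_open)
qed

text \<open>Near such a point all other elements stay away, so the closure of the domain is contained in that
  of \<open>K\<close> there; an open set that avoids \<open>K\<close> also avoids its closure and hence \<open>\<Omega>\<close>.\<close>

lemma good_point_boundary_normal:
  assumes x: "good_point x" and b: "x \<in> frontier \<Omega>" and K: "K \<in> \<T>" "x \<in> frontier K"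
  shows "is_outward_normal \<Omega> x (outward_normal K x)"
proof -
  obtain \<nu> where \<nu>: "is_outward_normal K x \<nu>" using x K by (auto simp: good_point_def)
  define F where "F = (\<Union>K'\<in>\<T> - {K}. closure K')"
  have "x \<notin> \<Omega>" using b open_domain by (auto simp: frontier_def interior_open)
  have "x \<notin> F"
  proof
    assume "x \<in> F"
    then obtain K' where K': "K' \<in> \<T>" "K' \<noteq> K" "x \<in> closure K'" by (auto simp: F_def)
    then have "x \<in> frontier K'"
      using \<open>x \<notin> \<Omega>\<close> element[OF K'(1)] by (auto simp: frontier_def interior_open)
    then show False using good_point_boundary_unique[OF x b K(1) K'(1) K(2)] K'(2) by simp
  qed
  moreover have "closed F" unfolding F_def using finite_mesh by (intro closed_UN) auto
  ultimately obtain r where r: "r > 0" "ball x r \<subseteq> - F"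
    using open_contains_ball[of "- F"] by (auto simp: open_Compl)
  have "is_outward_normal \<Omega> x \<nu>"
    unfolding is_outward_normal_def
  proof (intro conjI allI impI)
    show "norm \<nu> = 1" by (rule is_outward_normal_norm[OF \<nu>])
    fix \<epsilon> :: real assume "\<epsilon> > 0"
    then obtain \<delta> where \<delta>: "\<delta> > 0" and n: "\<forall>y\<in>ball x \<delta>.
        ((y - x) \<bullet> \<nu> < - \<epsilon> * norm (y - x) \<longrightarrow> y \<in> K) \<and> ((y - x) \<bullet> \<nu> > \<epsilon> * norm (y - x) \<longrightarrow> y \<notin> K)"
      using \<nu> unfolding is_outward_normal_def by blast
    define W where "W = ball x (min \<delta> r) \<inter> {y. \<epsilon> * norm (y - x) < (y - x) \<bullet> \<nu>}"
    have "open W" unfolding W_def by (intro open_Int open_ball open_Collect_less continuous_intros)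
    moreover have "W \<inter> K = {}" using n by (auto simp: W_def)
    ultimately have WK: "W \<inter> closure K = {}" by (simp add: open_Int_closure_eq_empty)
    have "W \<inter> F = {}" using r(2) by (auto simp: W_def)
    have "closure \<Omega> \<subseteq> closure K \<union> F" using closure_mesh by (auto simp: F_def)
    then have "W \<inter> \<Omega> = {}" using WK \<open>W \<inter> F = {}\<close> closure_subset[of \<Omega>] by blast
    show "\<exists>\<delta>>0. \<forall>y\<in>ball x \<delta>.
        ((y - x) \<bullet> \<nu> < - \<epsilon> * norm (y - x) \<longrightarrow> y \<in> \<Omega>) \<and> ((y - x) \<bullet> \<nu> > \<epsilon> * norm (y - x) \<longrightarrow> y \<notin> \<Omega>)"
    proof (intro exI[of _ "min \<delta> r"] conjI ballI impI)
      show "min \<delta> r > 0" using \<delta> r by simp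
      fix y assume y: "y \<in> ball x (min \<delta> r)"
      show "y \<in> \<Omega>" if "(y - x) \<bullet> \<nu> < - \<epsilon> * norm (y - x)"
        using n y that element(2)[OF K(1)] by auto
      show "y \<notin> \<Omega>" if "(y - x) \<bullet> \<nu> > \<epsilon> * norm (y - x)"
        using y that \<open>W \<inter> \<Omega> = {}\<close> by (auto simp: W_def)
    qed
  qed
  then show ?thesis by (simp add: outward_normal_eq[OF \<nu>])
qed

lemma emeasure_skeleton: "emeasure hausdorff1 (\<Union>K\<in>\<T>. frontier K) < \<infinity>"
proof -
  have "emeasure hausdorff1 (\<Union>K\<in>\<T>. frontier K) \<le> (\<Sum>K\<in>\<T>. emeasure hausdorff1 (frontier K))"
    using finite_mesh by (intro emeasure_subadditive_finite) auto
  also have "\<dots> < \<infinity>" using regular_element by (auto simp: regular_open_def less_top finite_mesh)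
  finally show ?thesis .
qed

lemma skeleton_sets [simp]: "(\<Union>K\<in>\<T>. frontier K) \<in> sets hausdorff1"
  using finite_mesh by (intro sets.finite_UN) auto

text \<open>The boundary of the domain inherits finite length and its normals from the elements.\<close>

lemma regular_domain: "regular_open \<Omega>"
  unfolding regular_open_def
proof (intro conjI open_domain bounded)
  have "frontier \<Omega> \<subseteq> (\<Union>K\<in>\<T>. frontier K)" using frontier_domain_element by blast
  then show "emeasure hausdorff1 (frontier \<Omega>) < \<infinity>"
    by (rule le_less_trans[OF emeasure_mono[OF _ skeleton_sets] emeasure_skeleton])
  show "AE x in hausdorff1. x \<in> frontier \<Omega> \<longrightarrow> (\<exists>\<nu>. is_outward_normal \<Omega> x \<nu>)"
    using AE_good_point
    by eventually_elim (use frontier_domain_element good_point_boundary_normal in blast)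
qed

lemma AE_domain_covered: "AE y in lebesgue. y \<in> (\<Union>K\<in>\<T>. K) \<longleftrightarrow> y \<in> \<Omega>"
proof -
  have "hausdorff1_outer (\<Union>K\<in>\<T>. frontier K) < \<infinity>"
    using emeasure_skeleton by (simp add: emeasure_hausdorff1)
  from AE_not_in[OF hausdorff1_finite_imp_lebesgue_null[OF this]] show ?thesis
  proof eventually_elim
    case (elim y)
    have "y \<in> (\<Union>K\<in>\<T>. K)" if "y \<in> \<Omega>"
    proof -
      have "y \<in> closure \<Omega>" using that closure_subset by (rule subsetD[rotated])
      then obtain K where K: "K \<in> \<T>" "y \<in> closure K" unfolding closure_mesh[symmetric] by blast
      then show ?thesis using elim element(1)[OF K(1)] by (auto simp: frontier_def interior_open)
    qed
    then show ?case using element(2) by blast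
  qed
qed

lemma sum_element_integrals:
  fixes F :: "plane \<Rightarrow> complex"
  assumes F: "set_integrable lebesgue \<Omega> F"
  shows "(\<Sum>K\<in>\<T>. LINT y:K|lebesgue. F y) = (LINT y:\<Omega>|lebesgue. F y)"
proof -
  have m: "K \<in> \<T> \<Longrightarrow> K \<in> sets lebesgue" for K using element(1) by simp
  then have U: "(\<Union>K\<in>\<T>. K) \<in> sets lebesgue" using finite_mesh by (intro sets.finite_UN) auto
  have iU: "set_integrable lebesgue (\<Union>K\<in>\<T>. K) F"
    using F U by (rule set_integrable_subset) (use element(2) in auto)
  have "(\<Sum>K\<in>\<T>. LINT y:K|lebesgue. F y) = (LINT y:(\<Union>K\<in>\<T>. K)|lebesgue. F y)"
    using finite_mesh disjoint_mesh m element(2)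
    by (intro set_integral_finite_Union[where A = "\<lambda>K. K" and I = \<T>, symmetric] set_integrable_subset[OF F])
      (auto simp: disjoint_family_on_def)
  also have "\<dots> = (LINT y:\<Omega>|lebesgue. F y)"
    using F iU AE_domain_covered
    by (intro set_integral_cong_set[symmetric])
      (auto simp: set_integrable_def set_borel_measurable_def borel_measurable_integrable)
  finally show ?thesis .
qed

lemma frontier_regular_open: "regular_open K \<Longrightarrow> frontier K \<in> sets hausdorff1 \<and> bounded (frontier K) \<and> emeasure hausdorff1 (frontier K) < \<infinity>"
  by (auto simp: regular_open_def compact_imp_bounded[OF compact_frontier_bounded])

lemma boundary_element_incident:
  assumes "x \<in> frontier \<Omega>"
  shows "boundary_element \<T> x \<in> \<T>" "x \<in> frontier (boundary_element \<T> x)"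
  using someI_ex[of "\<lambda>K. K \<in> \<T> \<and> x \<in> frontier K"] frontier_domain_element[OF assms]
  unfolding boundary_element_def by blast+

lemma sum_over_incident:
  fixes f :: "plane set \<Rightarrow> complex"
  shows "(\<Sum>K\<in>\<T>. indicator (frontier K) x *\<^sub>R f K) = sum f {K\<in>\<T>. x \<in> frontier K}"
  unfolding sum.inter_filter[OF finite_mesh] by (intro sum.cong refl) simp

context
  fixes \<kappa> u
  assumes u: "helmholtz_field \<kappa> \<Omega> u" and ub: "broken_trefftz \<kappa> \<T> u"
begin

lemma field_on_element: "K \<in> \<T> \<Longrightarrow> helmholtz_field \<kappa> K u"
  using ub by (simp add: broken_trefftz_def)

text \<open>Adding Green's formula over all elements gives Green's formula on the domain, as the skeleton is
  a Lebesgue null set. Comparing the boundary integrals for all test functions yields a pointwise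
  identity that contains both statements needed about \<open>u\<close>: on interior edges the right-hand side is
  zero and the left-hand side is the jump, and on the boundary it compares the two traces.\<close>

lemma AE_sum_traces:
  "AE x in hausdorff1. (\<Sum>K\<in>\<T>. indicator (frontier K) x *\<^sub>R (outward_normal K x $ j *\<^sub>R trace_on K u x)) =
     indicator (frontier \<Omega>) x *\<^sub>R (outward_normal \<Omega> x $ j *\<^sub>R trace_on \<Omega> u x)"
proof (rule AE_sum_eq_if_C1_test[OF finite_mesh])
  show "frontier \<Omega> \<in> sets hausdorff1" "bounded (frontier \<Omega>)" "emeasure hausdorff1 (frontier \<Omega>) < \<infinity>"
    using frontier_regular_open[OF regular_domain] by auto
  show "set_integrable hausdorff1 (frontier \<Omega>) (\<lambda>x. outward_normal \<Omega> x $ j *\<^sub>R trace_on \<Omega> u x)"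
    using is_trace_trace_on[OF u] by (intro set_integrable_boundary(2)[OF regular_domain]) (simp add: is_trace_def)
  fix \<phi> :: "plane \<Rightarrow> real" assume \<phi>: "C1_on UNIV \<phi>"
  let ?F = "\<lambda>y. \<phi> y *\<^sub>R pderiv2 j u y + pderiv2 j \<phi> y *\<^sub>R u y"
  have "(\<Sum>K\<in>\<T>. LINT x:frontier K|hausdorff1. \<phi> x *\<^sub>R (outward_normal K x $ j *\<^sub>R trace_on K u x)) =
    (\<Sum>K\<in>\<T>. LINT y:K|lebesgue. ?F y)"
    by (intro sum.cong refl is_trace_test[OF is_trace_trace_on[OF field_on_element] \<phi>])
  also have "\<dots> = (LINT y:\<Omega>|lebesgue. ?F y)"
    by (intro sum_element_integrals helmholtz_field_test_integrable(1)[OF u open_domain bounded \<phi>])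
  also have "\<dots> = (LINT x:frontier \<Omega>|hausdorff1. \<phi> x *\<^sub>R (outward_normal \<Omega> x $ j *\<^sub>R trace_on \<Omega> u x))"
    by (rule is_trace_test[OF is_trace_trace_on[OF u] \<phi>, symmetric])
  finally show "(\<Sum>K\<in>\<T>. LINT x:frontier K|hausdorff1. \<phi> x *\<^sub>R (outward_normal K x $ j *\<^sub>R trace_on K u x)) = \<dots>" .
next
  fix K assume K: "K \<in> \<T>"
  show "frontier K \<in> sets hausdorff1 \<and> bounded (frontier K) \<and> emeasure hausdorff1 (frontier K) < \<infinity>"
    by (rule frontier_regular_open[OF regular_element[OF K]])
  show "set_integrable hausdorff1 (frontier K) (\<lambda>x. outward_normal K x $ j *\<^sub>R trace_on K u x)"
    using is_trace_trace_on[OF field_on_element[OF K]]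
    by (intro set_integrable_boundary(2)[OF regular_element[OF K]]) (simp add: is_trace_def)
qed

lemma AE_sum_normal_derivatives:
  "AE x in hausdorff1. (\<Sum>K\<in>\<T>. indicator (frontier K) x *\<^sub>R normal_derivative K u x) =
     indicator (frontier \<Omega>) x *\<^sub>R normal_derivative \<Omega> u x"
proof (rule AE_sum_eq_if_C1_test[OF finite_mesh])
  note s = is_normal_derivative_normal_derivative
  show "frontier \<Omega> \<in> sets hausdorff1" "bounded (frontier \<Omega>)" "emeasure hausdorff1 (frontier \<Omega>) < \<infinity>"
    using frontier_regular_open[OF regular_domain] by auto
  show "set_integrable hausdorff1 (frontier \<Omega>) (normal_derivative \<Omega> u)"
    using s[OF u] by (intro set_integrable_boundary(1)[OF regular_domain]) (simp add: is_normal_derivative_def)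
  fix \<phi> :: "plane \<Rightarrow> real" assume \<phi>: "C1_on UNIV \<phi>"
  let ?F = "\<lambda>y. (\<Sum>j\<in>UNIV. pderiv2 j \<phi> y *\<^sub>R pderiv2 j u y) + \<phi> y *\<^sub>R laplacian u y"
  have "(\<Sum>K\<in>\<T>. LINT x:frontier K|hausdorff1. \<phi> x *\<^sub>R normal_derivative K u x) =
    (\<Sum>K\<in>\<T>. LINT y:K|lebesgue. ?F y)"
    by (intro sum.cong refl is_normal_derivative_test[OF s[OF field_on_element] \<phi>])
  also have "\<dots> = (LINT y:\<Omega>|lebesgue. ?F y)"
    by (intro sum_element_integrals helmholtz_field_test_integrable(2)[OF u open_domain bounded \<phi>])
  also have "\<dots> = (LINT x:frontier \<Omega>|hausdorff1. \<phi> x *\<^sub>R normal_derivative \<Omega> u x)"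
    by (rule is_normal_derivative_test[OF s[OF u] \<phi>, symmetric])
  finally show "(\<Sum>K\<in>\<T>. LINT x:frontier K|hausdorff1. \<phi> x *\<^sub>R normal_derivative K u x) = \<dots>" .
next
  fix K assume K: "K \<in> \<T>"
  show "frontier K \<in> sets hausdorff1 \<and> bounded (frontier K) \<and> emeasure hausdorff1 (frontier K) < \<infinity>"
    by (rule frontier_regular_open[OF regular_element[OF K]])
  show "set_integrable hausdorff1 (frontier K) (normal_derivative K u)"
    using is_normal_derivative_normal_derivative[OF field_on_element[OF K]]
    by (intro set_integrable_boundary(1)[OF regular_element[OF K]]) (simp add: is_normal_derivative_def)
qed

text \<open>Almost every point of an interior edge lies on the boundary of exactly its two neighbours and not
  on that of the domain.\<close>

lemma AE_no_jump:
  assumes p: "p \<in> interior_edges \<T>"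
  shows "AE x in hausdorff1. x \<in> edge p \<longrightarrow> jump p u x = 0 \<and> normal_jump_grad p u x = 0"
proof -
  obtain K K' where K: "K \<in> \<T>" "K' \<in> \<T>" "K \<noteq> K'" and pK: "p = {K, K'}"
    using p by (auto simp: interior_edges_def)
  have "AE x in hausdorff1. \<forall>j. (\<Sum>K\<in>\<T>. indicator (frontier K) x *\<^sub>R (outward_normal K x $ j *\<^sub>R trace_on K u x)) =
     indicator (frontier \<Omega>) x *\<^sub>R (outward_normal \<Omega> x $ j *\<^sub>R trace_on \<Omega> u x)"
    by (intro AE_all_countable[THEN iffD2] allI AE_sum_traces)
  with AE_good_point AE_sum_normal_derivatives show ?thesis
  proof eventually_elim
    case (elim x)
    show ?case
    proof
      assume "x \<in> edge p"
      then have x: "x \<in> frontier K" "x \<in> frontier K'" by (auto simp: edge_def pK)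
      have inc: "{K\<in>\<T>. x \<in> frontier K} = p"
        unfolding pK by (rule good_point_elements_eq[OF elim(1) K x])
      have "x \<notin> frontier \<Omega>" using good_point_boundary_unique[OF elim(1) _ K(1,2) x] K(3) by blast
      then have "\<forall>j. (\<Sum>K\<in>p. outward_normal K x $ j *\<^sub>R trace_on K u x) = 0"
        "(\<Sum>K\<in>p. normal_derivative K u x) = 0"
        using elim(2,3) unfolding sum_over_incident inc by auto
      then show "jump p u x = 0 \<and> normal_jump_grad p u x = 0"
        by (simp add: jump_def normal_jump_grad_def vec_eq_iff)
    qed
  qed
qed

text \<open>At almost every point of the boundary there is a single incident element, with the normal of the
  domain, so the sum has one term and the common unit normal can be cancelled.\<close>

lemma AE_boundary_data:
  "AE x in hausdorff1. x \<in> frontier \<Omega> \<longrightarrow>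
     boundary_trace \<T> u x = trace_on \<Omega> u x \<and> boundary_normal_derivative \<T> u x = normal_derivative \<Omega> u x"
proof -
  have "AE x in hausdorff1. \<forall>j. (\<Sum>K\<in>\<T>. indicator (frontier K) x *\<^sub>R (outward_normal K x $ j *\<^sub>R trace_on K u x)) =
     indicator (frontier \<Omega>) x *\<^sub>R (outward_normal \<Omega> x $ j *\<^sub>R trace_on \<Omega> u x)"
    by (intro AE_all_countable[THEN iffD2] allI AE_sum_traces)
  with AE_good_point AE_sum_normal_derivatives show ?thesis
  proof eventually_elim
    case (elim x)
    show ?case
    proof
      assume x: "x \<in> frontier \<Omega>"
      let ?K = "boundary_element \<T> x"
      note K = boundary_element_incident[OF x]
      have inc: "{K\<in>\<T>. x \<in> frontier K} = {?K}"
        using good_point_boundary_unique[OF elim(1) x _ K(1) _ K(2)] K by blast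
      have n: "is_outward_normal \<Omega> x (outward_normal ?K x)"
        by (rule good_point_boundary_normal[OF elim(1) x K])
      have "\<forall>j. outward_normal ?K x $ j *\<^sub>R trace_on ?K u x = outward_normal ?K x $ j *\<^sub>R trace_on \<Omega> u x"
        "normal_derivative ?K u x = normal_derivative \<Omega> u x"
        using elim(2,3) x unfolding sum_over_incident inc outward_normal_eq[OF n] by auto
      then show "boundary_trace \<T> u x = trace_on \<Omega> u x \<and> boundary_normal_derivative \<T> u x = normal_derivative \<Omega> u x"
        using scaled_normal_cancel[OF n, of "trace_on ?K u x" "trace_on \<Omega> u x"]
        unfolding boundary_trace_def boundary_normal_derivative_def by blast
    qed
  qed
qed

end

end

section \<open>Residual of the error\<close>

lemma edge_sets: "finite p \<Longrightarrow> p \<noteq> {} \<Longrightarrow> edge p \<in> sets hausdorff1"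
  unfolding edge_def by (intro closed_in_sets_hausdorff1 closed_INT ballI) simp

lemma norm_scaled_normal: "norm (\<chi> j. (\<nu> $ j) *\<^sub>R (d::complex)) = norm (\<nu> :: plane) * norm d"
  by (simp add: norm_vec_def L2_set_left_distrib)

lemma square_integrable_on_subset:
  assumes "square_integrable_on M A f" "B \<in> sets M" "B \<subseteq> A"
  shows "square_integrable_on M B f"
  using assms unfolding square_integrable_on_def
  by (auto intro: set_borel_measurable_subset set_integrable_subset)

lemma set_integral_nonneg: "(\<And>x. x \<in> A \<Longrightarrow> 0 \<le> f x) \<Longrightarrow> 0 \<le> (LINT x:A|M. f x :: real)"
  unfolding set_lebesgue_integral_def by (intro integral_nonneg_AE AE_I2) (auto simp: indicator_def)

lemma L2norm_power2: "(L2norm M A f)\<^sup>2 = (LINT x:A|M. (norm (f x))\<^sup>2)"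
  unfolding L2norm_def by (simp add: set_integral_nonneg)

lemma L2norm_power2_cong_AE:
  fixes f :: "plane \<Rightarrow> 'b::real_normed_vector" and g :: "plane \<Rightarrow> 'c::real_normed_vector"
  assumes "AE x in hausdorff1. x \<in> A \<longrightarrow> norm (f x) = norm (g x)"
  shows "(L2norm hausdorff1 A f)\<^sup>2 = (L2norm hausdorff1 A g)\<^sup>2"
proof -
  interpret H: complete_measure "hausdorff1 :: plane measure" by (rule complete_measure_hausdorff1)
  show ?thesis unfolding L2norm_power2
    by (rule H.set_integral_cong_AE_complete) (use assms in eventually_elim, simp)
qed

context domain_mesh begin

lemma AE_jump_diff:
  assumes p: "p \<in> interior_edges \<T>" and u: "broken_trefftz \<kappa> \<T> u" and v: "broken_trefftz \<kappa> \<T> v"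
  shows "AE x in hausdorff1. x \<in> edge p \<longrightarrow>
    jump p (\<lambda>x. u x - v x) x = jump p u x - jump p v x \<and>
    normal_jump_grad p (\<lambda>x. u x - v x) x = normal_jump_grad p u x - normal_jump_grad p v x"
proof -
  have pT: "p \<subseteq> \<T>" "finite p" using p by (auto simp: interior_edges_def)
  have h: "helmholtz_field \<kappa> K u" "helmholtz_field \<kappa> K v" if "K \<in> p" for K
    using u v pT that by (auto simp: broken_trefftz_def)
  have r: "regular_open K" if "K \<in> p" for K using pT that regular_element by blast
  have "AE x in hausdorff1. \<forall>K\<in>p. x \<in> frontier K \<longrightarrow> trace_on K (\<lambda>x. u x - v x) x = trace_on K u x - trace_on K v x"
    by (intro AE_finite_allI[OF pT(2)] trace_on_diff[where \<kappa> = \<kappa>] r h)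
  moreover have "AE x in hausdorff1. \<forall>K\<in>p. x \<in> frontier K \<longrightarrow>
      normal_derivative K (\<lambda>x. u x - v x) x = normal_derivative K u x - normal_derivative K v x"
    by (intro AE_finite_allI[OF pT(2)] normal_derivative_diff[where \<kappa> = \<kappa>] r h)
  ultimately show ?thesis
  proof eventually_elim
    case (elim x)
    show ?case
    proof
      assume "x \<in> edge p"
      then have x: "x \<in> frontier K" if "K \<in> p" for K using that by (simp add: edge_def)
      have "jump p (\<lambda>x. u x - v x) x =
          (\<Sum>K\<in>p. (\<chi> j. outward_normal K x $ j *\<^sub>R trace_on K u x) - (\<chi> j. outward_normal K x $ j *\<^sub>R trace_on K v x))"
        unfolding jump_def
        by (intro sum.cong refl) (use elim(1) x in \<open>auto simp: vec_eq_iff scaleR_diff_right\<close>)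
      moreover have "normal_jump_grad p (\<lambda>x. u x - v x) x = (\<Sum>K\<in>p. normal_derivative K u x - normal_derivative K v x)"
        unfolding normal_jump_grad_def by (intro sum.cong refl) (use elim(2) x in simp)
      ultimately show "jump p (\<lambda>x. u x - v x) x = jump p u x - jump p v x \<and>
          normal_jump_grad p (\<lambda>x. u x - v x) x = normal_jump_grad p u x - normal_jump_grad p v x"
        by (simp add: jump_def normal_jump_grad_def sum_subtractf)
    qed
  qed
qed

lemma AE_boundary_diff:
  assumes u: "broken_trefftz \<kappa> \<T> u" and v: "broken_trefftz \<kappa> \<T> v"
  shows "AE x in hausdorff1. x \<in> frontier \<Omega> \<longrightarrow>
    boundary_trace \<T> (\<lambda>x. u x - v x) x = boundary_trace \<T> u x - boundary_trace \<T> v x \<and>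
    boundary_normal_derivative \<T> (\<lambda>x. u x - v x) x =
      boundary_normal_derivative \<T> u x - boundary_normal_derivative \<T> v x"
proof -
  have h: "helmholtz_field \<kappa> K u" "helmholtz_field \<kappa> K v" if "K \<in> \<T>" for K
    using u v that by (auto simp: broken_trefftz_def)
  have "AE x in hausdorff1. \<forall>K\<in>\<T>. x \<in> frontier K \<longrightarrow> trace_on K (\<lambda>x. u x - v x) x = trace_on K u x - trace_on K v x"
    by (intro AE_finite_allI[OF finite_mesh] trace_on_diff[where \<kappa> = \<kappa>] regular_element h)
  moreover have "AE x in hausdorff1. \<forall>K\<in>\<T>. x \<in> frontier K \<longrightarrow>
      normal_derivative K (\<lambda>x. u x - v x) x = normal_derivative K u x - normal_derivative K v x"
    by (intro AE_finite_allI[OF finite_mesh] normal_derivative_diff[where \<kappa> = \<kappa>] regular_element h)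
  ultimately show ?thesis
  proof eventually_elim
    case (elim x)
    then show ?case
      using boundary_element_incident[of x]
      unfolding boundary_trace_def boundary_normal_derivative_def by blast
  qed
qed

lemma broken_trefftz_diff:
  "broken_trefftz \<kappa> \<T> u \<Longrightarrow> broken_trefftz \<kappa> \<T> v \<Longrightarrow> broken_trefftz \<kappa> \<T> (\<lambda>x. u x - v x)"
  unfolding broken_trefftz_def by (auto intro: helmholtz_field_diff regular_element)

text \<open>The jump has the norm of the difference of the two traces because almost everywhere the normals are
  opposite unit vectors. Integrability is what allows the edge integrals of the residual to be split.\<close>

lemma square_integrable_jumps:
  assumes p: "p \<in> interior_edges \<T>" and v: "broken_trefftz \<kappa> \<T> v"
  shows "set_integrable hausdorff1 (edge p) (\<lambda>x. (norm (jump p v x))\<^sup>2)"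
    and "set_integrable hausdorff1 (edge p) (\<lambda>x. (norm (normal_jump_grad p v x))\<^sup>2)"
proof -
  interpret H: complete_measure "hausdorff1 :: plane measure" by (rule complete_measure_hausdorff1)
  obtain K K' where K: "K \<in> \<T>" "K' \<in> \<T>" "K \<noteq> K'" and pK: "p = {K, K'}"
    using p by (auto simp: interior_edges_def)
  have h: "helmholtz_field \<kappa> K v" "helmholtz_field \<kappa> K' v"
    using v K by (auto simp: broken_trefftz_def)
  have e: "edge p \<in> sets hausdorff1" "edge p \<subseteq> frontier K" "edge p \<subseteq> frontier K'"
    by (auto simp: pK edge_sets) (auto simp: edge_def)
  have t: "square_integrable_on hausdorff1 (edge p) (trace_on L v)"
      "square_integrable_on hausdorff1 (edge p) (normal_derivative L v)"
    if "helmholtz_field \<kappa> L v" "edge p \<subseteq> frontier L" for L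
    using is_trace_trace_on[OF that(1)] is_normal_derivative_normal_derivative[OF that(1)] e(1) that(2)
    by (auto simp: is_trace_def is_normal_derivative_def intro: square_integrable_on_subset)
  have "square_integrable_on hausdorff1 (edge p) (\<lambda>x. trace_on K v x - trace_on K' v x)"
    by (intro square_integrable_on_diff t h e)
  then have i: "set_integrable hausdorff1 (edge p) (\<lambda>x. (norm (trace_on K v x - trace_on K' v x))\<^sup>2)"
    by (simp add: square_integrable_on_def)
  have "AE x in hausdorff1. x \<in> edge p \<longrightarrow> (norm (jump p v x))\<^sup>2 = (norm (trace_on K v x - trace_on K' v x))\<^sup>2"
    using AE_good_point
  proof eventually_elim
    case (elim x)
    show ?case
    proof
      assume "x \<in> edge p"
      then have "x \<in> frontier K" "x \<in> frontier K'" using e by auto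
      then obtain \<nu> where \<nu>: "is_outward_normal K x \<nu>" "is_outward_normal K' x (- \<nu>)"
        using good_point_opposite[OF elim K] by blast
      have "jump p v x = (\<chi> j. (\<nu> $ j) *\<^sub>R (trace_on K v x - trace_on K' v x))"
        using K(3) by (simp add: pK jump_def outward_normal_eq[OF \<nu>(1)] outward_normal_eq[OF \<nu>(2)] vec_eq_iff algebra_simps)
      then show "(norm (jump p v x))\<^sup>2 = (norm (trace_on K v x - trace_on K' v x))\<^sup>2"
        by (simp add: norm_scaled_normal is_outward_normal_norm[OF \<nu>(1)])
    qed
  qed
  from H.set_integrable_cong_AE_iff[OF this] i
  show "set_integrable hausdorff1 (edge p) (\<lambda>x. (norm (jump p v x))\<^sup>2)" by simp
  \<comment> \<open>The sum of the normal derivatives, written as a difference.\<close>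
  have m: "square_integrable_on hausdorff1 (edge p) (\<lambda>x. 0 - normal_derivative K' v x)"
    by (intro square_integrable_on_diff t h e) (simp add: square_integrable_on_def set_borel_measurable_def set_integrable_def)
  have "square_integrable_on hausdorff1 (edge p) (\<lambda>x. normal_derivative K v x - (0 - normal_derivative K' v x))"
    by (intro square_integrable_on_diff[OF _ m] t h e)
  then show "set_integrable hausdorff1 (edge p) (\<lambda>x. (norm (normal_jump_grad p v x))\<^sup>2)"
    using K(3) by (simp add: square_integrable_on_def pK normal_jump_grad_def)
qed

lemma skeleton_residual_L2norm:
  assumes v: "broken_trefftz \<kappa> \<T> v"
  shows "skeleton_residual \<kappa> \<T> \<Gamma>D \<Gamma>R g \<alpha> \<beta> v =
    (\<Sum>p\<in>interior_edges \<T>. \<alpha> * \<kappa> * (L2norm hausdorff1 (edge p) (jump p v))\<^sup>2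
       + \<beta> / \<kappa> * (L2norm hausdorff1 (edge p) (normal_jump_grad p v))\<^sup>2)
    + \<alpha> * \<kappa> * (L2norm hausdorff1 \<Gamma>D (\<lambda>x. boundary_trace \<T> v x - g x))\<^sup>2
    + 1 / (2 * \<kappa>) * (L2norm hausdorff1 \<Gamma>R
        (\<lambda>x. boundary_normal_derivative \<T> v x + \<i> * of_real \<kappa> * boundary_trace \<T> v x))\<^sup>2"
proof -
  have "(LINT x:edge p|hausdorff1. \<alpha> * \<kappa> * (norm (jump p v x))\<^sup>2 + \<beta> / \<kappa> * (norm (normal_jump_grad p v x))\<^sup>2)
      = \<alpha> * \<kappa> * (L2norm hausdorff1 (edge p) (jump p v))\<^sup>2
       + \<beta> / \<kappa> * (L2norm hausdorff1 (edge p) (normal_jump_grad p v))\<^sup>2"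
    if "p \<in> interior_edges \<T>" for p
    using square_integrable_jumps[OF that v]
    by (subst set_integral_add(2)) (auto simp: L2norm_power2 intro!: set_integrable_mult_right simp del: times_divide_eq_left)
  then show ?thesis unfolding skeleton_residual_def L2norm_power2 by simp
qed

text \<open>Almost everywhere on the skeleton the data of the error \<open>w\<close> are those of \<open>- v\<close>, up to the Dirichlet datum:
  \<open>u\<close> does not jump, equals \<open>g\<close> on \<open>\<Gamma>D\<close> and satisfies the homogeneous Robin condition on \<open>\<Gamma>R\<close>.\<close>

lemma error_skeleton_norms:
  assumes \<Gamma>: "frontier \<Omega> = \<Gamma>D \<union> \<Gamma>R"
    and u: "solves_helmholtz_bvp \<kappa> \<Omega> \<Gamma>D \<Gamma>R g u" and ub: "broken_trefftz \<kappa> \<T> u"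
    and v: "broken_trefftz \<kappa> \<T> v"
  defines "w \<equiv> \<lambda>x. u x - v x"
  shows "p \<in> interior_edges \<T> \<Longrightarrow> (L2norm hausdorff1 (edge p) (jump p w))\<^sup>2 = (L2norm hausdorff1 (edge p) (jump p v))\<^sup>2"
    and "p \<in> interior_edges \<T> \<Longrightarrow>
      (L2norm hausdorff1 (edge p) (normal_jump_grad p w))\<^sup>2 = (L2norm hausdorff1 (edge p) (normal_jump_grad p v))\<^sup>2"
    and "(L2norm hausdorff1 \<Gamma>D (boundary_trace \<T> w))\<^sup>2 = (L2norm hausdorff1 \<Gamma>D (\<lambda>x. boundary_trace \<T> v x - g x))\<^sup>2"
    and "(L2norm hausdorff1 \<Gamma>R (\<lambda>x. boundary_normal_derivative \<T> w x + \<i> * of_real \<kappa> * boundary_trace \<T> w x))\<^sup>2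
      = (L2norm hausdorff1 \<Gamma>R (\<lambda>x. boundary_normal_derivative \<T> v x + \<i> * of_real \<kappa> * boundary_trace \<T> v x))\<^sup>2"
proof -
  have hu: "helmholtz_field \<kappa> \<Omega> u" using u by (simp add: solves_helmholtz_bvp_def)
  have D: "AE x in hausdorff1. x \<in> \<Gamma>D \<longrightarrow> trace_on \<Omega> u x = g x"
    and R: "AE x in hausdorff1. x \<in> \<Gamma>R \<longrightarrow> normal_derivative \<Omega> u x + \<i> * of_real \<kappa> * trace_on \<Omega> u x = 0"
    using u by (auto simp: solves_helmholtz_bvp_def)
  note bd = AE_boundary_data[OF hu ub] AE_boundary_diff[OF ub v, folded w_def]
  {
    assume p: "p \<in> interior_edges \<T>"
    note pd = AE_no_jump[OF hu ub p] AE_jump_diff[OF p ub v, folded w_def]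
    show "(L2norm hausdorff1 (edge p) (jump p w))\<^sup>2 = (L2norm hausdorff1 (edge p) (jump p v))\<^sup>2"
      by (rule L2norm_power2_cong_AE) (use pd in eventually_elim, simp)
    show "(L2norm hausdorff1 (edge p) (normal_jump_grad p w))\<^sup>2 = (L2norm hausdorff1 (edge p) (normal_jump_grad p v))\<^sup>2"
      by (rule L2norm_power2_cong_AE) (use pd in eventually_elim, simp)
  }
  show "(L2norm hausdorff1 \<Gamma>D (boundary_trace \<T> w))\<^sup>2 = (L2norm hausdorff1 \<Gamma>D (\<lambda>x. boundary_trace \<T> v x - g x))\<^sup>2"
    by (rule L2norm_power2_cong_AE) (use bd D in eventually_elim, simp add: \<Gamma> norm_minus_commute)
  show "(L2norm hausdorff1 \<Gamma>R (\<lambda>x. boundary_normal_derivative \<T> w x + \<i> * of_real \<kappa> * boundary_trace \<T> w x))\<^sup>2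
      = (L2norm hausdorff1 \<Gamma>R (\<lambda>x. boundary_normal_derivative \<T> v x + \<i> * of_real \<kappa> * boundary_trace \<T> v x))\<^sup>2"
  proof (rule L2norm_power2_cong_AE)
    show "AE x in hausdorff1. x \<in> \<Gamma>R \<longrightarrow>
      norm (boundary_normal_derivative \<T> w x + \<i> * of_real \<kappa> * boundary_trace \<T> w x) =
      norm (boundary_normal_derivative \<T> v x + \<i> * of_real \<kappa> * boundary_trace \<T> v x)"
      using bd R
    proof eventually_elim
      case (elim x)
      show ?case
      proof
        assume "x \<in> \<Gamma>R"
        then have x: "x \<in> frontier \<Omega>" "normal_derivative \<Omega> u x + \<i> * of_real \<kappa> * trace_on \<Omega> u x = 0"
          using elim(3) \<Gamma> by auto
        have e: "boundary_trace \<T> w x = trace_on \<Omega> u x - boundary_trace \<T> v x"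
          "boundary_normal_derivative \<T> w x = normal_derivative \<Omega> u x - boundary_normal_derivative \<T> v x"
          using elim(1,2) x(1) by auto
        have "boundary_normal_derivative \<T> w x + \<i> * of_real \<kappa> * boundary_trace \<T> w x =
          (normal_derivative \<Omega> u x + \<i> * of_real \<kappa> * trace_on \<Omega> u x)
          - (boundary_normal_derivative \<T> v x + \<i> * of_real \<kappa> * boundary_trace \<T> v x)"
          unfolding e by (simp add: right_diff_distrib)
        then show "norm (boundary_normal_derivative \<T> w x + \<i> * of_real \<kappa> * boundary_trace \<T> w x) =
          norm (boundary_normal_derivative \<T> v x + \<i> * of_real \<kappa> * boundary_trace \<T> v x)"
          unfolding x(2) by (metis diff_0 norm_minus_cancel)
      qed
    qed
  qed
qed

end

lemma weighted_residual_le: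
  fixes j n :: "'i \<Rightarrow> real"
  assumes M: "a \<le> M * a'" "b \<le> M * b'" "c \<le> M * c'" "d \<le> M * d'"
    and nn: "\<And>p. p \<in> I \<Longrightarrow> 0 \<le> j p" "\<And>p. p \<in> I \<Longrightarrow> 0 \<le> n p" "0 \<le> D" "0 \<le> R"
  shows "(\<Sum>p\<in>I. a * j p + b * n p) + c * D + d * R
    \<le> M * ((\<Sum>p\<in>I. a' * j p + b' * n p) + c' * D + d' * R)"
proof -
  have "(\<Sum>p\<in>I. a * j p + b * n p) \<le> (\<Sum>p\<in>I. M * a' * j p + M * b' * n p)"
    using M nn by (intro sum_mono add_mono mult_right_mono) auto
  moreover have "c * D \<le> M * c' * D" "d * R \<le> M * d' * R"
    using M nn by (auto intro: mult_right_mono)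
  ultimately show ?thesis by (simp add: distrib_left sum_distrib_left mult.assoc)
qed

theorem proposition4p3:
  fixes \<Omega> \<Gamma>D \<Gamma>R :: "plane set" and \<T> :: "plane set set"
    and \<kappa> \<alpha> \<beta> Cstab :: real and g u v\<^sub>h :: "plane \<Rightarrow> complex"
  assumes "lipschitz_domain \<Omega>" and "bounded \<Omega>"
    and "frontier \<Omega> = \<Gamma>D \<union> \<Gamma>R" and "\<Gamma>D \<inter> \<Gamma>R = {}"
    and "\<Gamma>D \<in> sets hausdorff1" and "\<Gamma>R \<in> sets hausdorff1"
    and "\<kappa> > 0" and "\<alpha> > 0" and "\<beta> > 0"
    and "mesh_of \<Omega> \<T>"
    and "stability_estimate \<kappa> \<Omega> \<T> \<Gamma>D \<Gamma>R Cstab"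
    and "solves_helmholtz_bvp \<kappa> \<Omega> \<Gamma>D \<Gamma>R g u" and "broken_trefftz \<kappa> \<T> u"
    and "broken_trefftz \<kappa> \<T> v\<^sub>h"
  shows "L2norm lebesgue \<Omega> (\<lambda>x. u x - v\<^sub>h x)
             \<le> C_J \<alpha> \<beta> * Cstab * sqrt (skeleton_residual \<kappa> \<T> \<Gamma>D \<Gamma>R g \<alpha> \<beta> v\<^sub>h)
         \<and> C_J (1/2) (1/2) = sqrt 2"
proof
  interpret domain_mesh \<Omega> \<T> using assms by unfold_locales
  note pos = \<open>\<kappa> > 0\<close> \<open>\<alpha> > 0\<close> \<open>\<beta> > 0\<close>
  define w where "w x = u x - v\<^sub>h x" for x
  define j where "j p = (L2norm hausdorff1 (edge p) (jump p v\<^sub>h))\<^sup>2" for p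
  define n where "n p = (L2norm hausdorff1 (edge p) (normal_jump_grad p v\<^sub>h))\<^sup>2" for p
  define D where "D = (L2norm hausdorff1 \<Gamma>D (\<lambda>x. boundary_trace \<T> v\<^sub>h x - g x))\<^sup>2"
  define R where "R = (L2norm hausdorff1 \<Gamma>R
    (\<lambda>x. boundary_normal_derivative \<T> v\<^sub>h x + \<i> * of_real \<kappa> * boundary_trace \<T> v\<^sub>h x))\<^sup>2"
  have nn: "0 \<le> j p" "0 \<le> n p" "0 \<le> D" "0 \<le> R" for p by (auto simp: j_def n_def D_def R_def)
  define S where "S = (\<Sum>p\<in>interior_edges \<T>. \<kappa> * j p + 1 / \<kappa> * n p) + \<kappa> * D + 1 / \<kappa> * R"
  define J where "J = skeleton_residual \<kappa> \<T> \<Gamma>D \<Gamma>R g \<alpha> \<beta> v\<^sub>h"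
  have J: "J = (\<Sum>p\<in>interior_edges \<T>. \<alpha> * \<kappa> * j p + \<beta> / \<kappa> * n p) + \<alpha> * \<kappa> * D + 1 / (2 * \<kappa>) * R"
    unfolding J_def skeleton_residual_L2norm[OF \<open>broken_trefftz \<kappa> \<T> v\<^sub>h\<close>] j_def n_def D_def R_def ..
  have w_Trefftz: "broken_trefftz \<kappa> \<T> w"
    unfolding w_def using assms by (intro broken_trefftz_diff)
  have w_eq: "w = (\<lambda>x. u x - v\<^sub>h x)" by (simp add: w_def fun_eq_iff)
  note norms = error_skeleton_norms[OF assms(3,12,13,14), folded w_eq]
  have stab: "L2norm lebesgue \<Omega> w \<le> Cstab * sqrt S"
  proof -
    have "S = (\<Sum>p\<in>interior_edges \<T>. \<kappa> * (L2norm hausdorff1 (edge p) (jump p w))\<^sup>2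
          + 1 / \<kappa> * (L2norm hausdorff1 (edge p) (normal_jump_grad p w))\<^sup>2)
       + \<kappa> * (L2norm hausdorff1 \<Gamma>D (boundary_trace \<T> w))\<^sup>2
       + 1 / \<kappa> * (L2norm hausdorff1 \<Gamma>R
           (\<lambda>x. boundary_normal_derivative \<T> w x + \<i> * of_real \<kappa> * boundary_trace \<T> w x))\<^sup>2"
      unfolding S_def j_def n_def D_def R_def norms(3,4)
      by (intro arg_cong2[where f = "(+)"] sum.cong refl) (simp_all add: norms(1,2))
    moreover note \<open>stability_estimate \<kappa> \<Omega> \<T> \<Gamma>D \<Gamma>R Cstab\<close>[unfolded stability_estimate_def, rule_format, OF w_Trefftz]
    ultimately show ?thesis by (simp only:)
  qed
  define M where "M = Max {inverse \<alpha>, inverse \<beta>, 2}"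
  have M: "inverse \<alpha> \<le> M" "inverse \<beta> \<le> M" "2 \<le> M" by (auto simp: M_def)
  have M_weights: "1 \<le> M * \<alpha>" "1 \<le> M * \<beta>"
    using mult_right_mono[OF M(1), of \<alpha>] mult_right_mono[OF M(2), of \<beta>] pos by auto
  have "S \<le> M * J"
    unfolding S_def J
  proof (rule weighted_residual_le)
    show *: "\<kappa> \<le> M * (\<alpha> * \<kappa>)" using mult_right_mono[OF M_weights(1), of \<kappa>] pos by (simp add: mult.assoc)
    show "\<kappa> \<le> M * (\<alpha> * \<kappa>)" by (rule *)
    show "1 / \<kappa> \<le> M * (\<beta> / \<kappa>)" using divide_right_mono[OF M_weights(2), of \<kappa>] pos by simp
    show "1 / \<kappa> \<le> M * (1 / (2 * \<kappa>))" using divide_right_mono[OF M(3), of "2 * \<kappa>"] pos by simp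
  qed (rule nn)+
  \<comment> \<open>A converse bound, for the case of a negative stability constant below.\<close>
  define N where "N = max 1 (max \<alpha> \<beta>)"
  have N: "1 \<le> N" "\<alpha> \<le> N" "\<beta> \<le> N" by (auto simp: N_def)
  have "J \<le> N * S"
    unfolding S_def J
  proof (rule weighted_residual_le)
    show *: "\<alpha> * \<kappa> \<le> N * \<kappa>" using N pos by simp
    show "\<alpha> * \<kappa> \<le> N * \<kappa>" by (rule *)
    show "\<beta> / \<kappa> \<le> N * (1 / \<kappa>)" using divide_right_mono[OF N(3), of \<kappa>] pos by simp
    have "1 / (2 * \<kappa>) \<le> 1 / \<kappa>" using pos by (simp add: divide_simps)
    also have "\<dots> \<le> N * (1 / \<kappa>)" using divide_right_mono[OF N(1), of \<kappa>] pos by simp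
    finally show "1 / (2 * \<kappa>) \<le> N * (1 / \<kappa>)" .
  qed (rule nn)+
  have J0: "0 \<le> J" unfolding J using nn pos by (intro add_nonneg_nonneg sum_nonneg mult_nonneg_nonneg) auto
  have C: "C_J \<alpha> \<beta> * Cstab * sqrt J = Cstab * sqrt (M * J)"
    by (simp add: C_J_def M_def real_sqrt_mult)
  have "L2norm lebesgue \<Omega> w \<le> C_J \<alpha> \<beta> * Cstab * sqrt J"
  proof (cases "Cstab \<ge> 0")
    case True
    then show ?thesis
      using stab \<open>S \<le> M * J\<close> unfolding C by (meson mult_left_mono order_trans real_sqrt_le_mono)
  next
    case False
    \<comment> \<open>A negative constant in the stability estimate forces \<open>S = 0\<close>; then also \<open>J = 0\<close>.\<close>
    have "0 \<le> L2norm lebesgue \<Omega> w" by (simp add: L2norm_def set_integral_nonneg)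
    then have "0 \<le> Cstab * sqrt S" using stab by linarith
    then have "S \<le> 0" using False by (simp add: zero_le_mult_iff)
    then have "N * S \<le> 0" using N(1) by (intro mult_nonneg_nonpos) auto
    then have "J = 0" using \<open>J \<le> N * S\<close> J0 by linarith
    moreover have "0 \<le> S" unfolding S_def using nn pos by (intro add_nonneg_nonneg sum_nonneg mult_nonneg_nonneg) auto
    ultimately show ?thesis using \<open>S \<le> 0\<close> stab by simp
  qed
  then show "L2norm lebesgue \<Omega> (\<lambda>x. u x - v\<^sub>h x)
      \<le> C_J \<alpha> \<beta> * Cstab * sqrt (skeleton_residual \<kappa> \<T> \<Gamma>D \<Gamma>R g \<alpha> \<beta> v\<^sub>h)"
    by (simp add: w_eq J_def)
  show "C_J (1/2) (1/2) = sqrt 2" by (simp add: C_J_def)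
qed

end
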